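(* Let $\Omega\subset E_k$ be a domain and let $\Phi:\Omega\to\mathbb{A}_n^m$ be a monogenic function in $\Omega$. Then for every closed Jordan rectifiable curve $\gamma\subset\Omega$ homotopic to a point in $\Omega$, $$\int_{\gamma}\Phi(\zeta)\,d\zeta=0.$$
   Context: Algebra. Let $m\le n$ be natural numbers. $\mathbb{A}_n^m$ is an arbitrary $n$-dimensional commutative associative algebra with unit over $\mathbb{C}$, having a basis $\{I_r\}_{r=1}^n$ with the multiplication rules (such a basis exists by a theorem of E. Cartan): (1) for $r,s\in\{1,\dots,m\}$, $I_rI_s=0$ if $r\ne s$ and $I_rI_r=I_r$; (2) for $r,s\in\{m+1,\dots,n\}$, $I_rI_s=\sum_{p=\max\{r,s\}+1}^n\Upsilon_{r,p}^{s}I_p$ with structure constants $\Upsilon_{r,p}^s\in\mathbb{C}$; (3) for every $s\in\{m+1,\dots,n\}$ there is a unique $u_s\in\{1,\dots,m\}$ such that for all $r\in\{1,\dots,m\}$, $I_rI_s=I_s$ if $r=u_s$ and $I_rI_s=0$ if $r\neq u_s$. The unit is $1=\sum_{u=1}^m I_u$. For $u=1,\dots,m$ the functional $f_u:\mathbb{A}_n^m\to\mathbb{C}$ is the $\mathbb{C}$-linear (multiplicative) functional with $f_u(I_u)=1$ and $f_u(I_r)=0$ for all $r\neq u$. The subspace $E_k$. Let $2\le k\le 2n$ and let $e_1=1,e_2,\dots,e_k\in\mathbb{A}_n^m$ be linearly independent over $\mathbb{R}$. Put $E_k=\{\zeta=\sum_{j=1}^k x_je_j:\ x_j\in\mathbb{R}\}$.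 Standing assumption: $f_u(E_k)=\mathbb{C}$ for all $u=1,\dots,m$. $E_k$ is identified with $\mathbb{R}^k$ through the coordinates $(x_1,\dots,x_k)$; all topological and metric notions for subsets of $E_k$ (domain, rectifiability, homotopy, etc.) are those of the corresponding subsets of $\mathbb{R}^k$; for $Q\subset E_k$ the corresponding subset of $\mathbb{R}^k$ is $Q_{\mathbb{R}}$. A domain is a nonempty open connected set. Monogenic functions. A continuous function $\Phi:\Omega\to\mathbb{A}_n^m$ is monogenic in the domain $\Omega\subset E_k$ if for every $\zeta\in\Omega$ there is an element $\Phi'(\zeta)\in\mathbb{A}_n^m$ such that $\lim_{\varepsilon\to0+0}\left(\Phi(\zeta+\varepsilon h)-\Phi(\zeta)\right)\varepsilon^{-1}=h\Phi'(\zeta)$ for all $h\in E_k$. Integral. For a Jordan rectifiable curve $\gamma\subset E_k$ and a continuous $\Psi=\sum_{r=1}^n (U_r+iV_r)I_r:\gamma\to\mathbb{A}_n^m$ with real-valued functions $U_r,V_r$ of $(x_1,\dots,x_k)\in\gamma_{\mathbb{R}}$, $$\int_\gamma\Psi(\zeta)\,d\zeta:=\sum_{j=1}^k e_j\sum_{r=1}^n I_r\int_{\gamma_{\mathbb{R}}}U_r\,dx_j+i\sum_{j=1}^k e_j\sum_{r=1}^n I_r\int_{\gamma_{\mathbb{R}}}V_r\,dx_j .$$ *)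

theory Defs
  imports "HOL-Analysis.Analysis"
begin

section \<open>Rectifiable curves and line integrals in coordinates\<close>

text \<open>The members of a division of \<open>[0,1]\<close> are compact intervals \<open>K = [Inf K, Sup K]\<close>, so the sum
  below is the length of an inscribed polygon.\<close>

definition rectifiable :: "(real \<Rightarrow> real ^ 'k) \<Rightarrow> bool" where
  "rectifiable g \<longleftrightarrow> path g \<and>
     (\<exists>L. \<forall>D. D division_of {0..1} \<longrightarrow> (\<Sum>K\<in>D. dist (g (Inf K)) (g (Sup K))) \<le> L)"

definition closed_jordan_rectifiable :: "(real \<Rightarrow> real ^ 'k) \<Rightarrow> bool" where
  "closed_jordan_rectifiable g \<longleftrightarrow> simple_path g \<and> pathfinish g = pathstart g \<and> rectifiable g"

text \<open>The Riemann--Stieltjes integral of \<open>u\<close> with respect to \<open>g\<close> over \<open>[0,1]\<close>, as the limit of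
  Riemann--Stieltjes sums over tagged divisions whose mesh tends to zero. It exists whenever \<open>u\<close> is
  continuous and \<open>g\<close> is continuous of bounded variation. The curves are merely rectifiable, so an
  integral based on the derivative of the parametrization is not available.\<close>

definition has_stieltjes_integral :: "(real \<Rightarrow> real) \<Rightarrow> (real \<Rightarrow> real) \<Rightarrow> real \<Rightarrow> bool" where
  "has_stieltjes_integral u g J \<longleftrightarrow>
     (\<forall>\<epsilon>>0. \<exists>\<delta>>0. \<forall>p. p tagged_division_of {0..1} \<and> (\<forall>(t, K)\<in>p. diameter K < \<delta>) \<longrightarrow>
        \<bar>(\<Sum>(t, K)\<in>p. u t * (g (Sup K) - g (Inf K))) - J\<bar> < \<epsilon>)"

text \<open>\<open>line_integral U \<gamma> j\<close> is the integral of \<open>U dx\<^sub>j\<close> along \<open>\<gamma>\<close>.\<close>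

definition line_integral :: "(real ^ 'k \<Rightarrow> real) \<Rightarrow> (real \<Rightarrow> real ^ 'k) \<Rightarrow> 'k \<Rightarrow> real" where
  "line_integral U \<gamma> j = (THE J. has_stieltjes_integral (\<lambda>t. U (\<gamma> t)) (\<lambda>t. \<gamma> t $ j) J)"


section \<open>The algebra and its Cartan basis\<close>

text \<open>The unital commutative complex algebra is the whole type \<open>'a\<close>, with scalar multiplication
  \<open>scale\<close>; its complex dimension is the number \<open>n\<close>.\<close>

locale cartan_algebra = vector_space scale
  for scale :: "complex \<Rightarrow> 'a::comm_ring_1 \<Rightarrow> 'a" +
  fixes n m :: nat
    and I :: "nat \<Rightarrow> 'a"
    and \<Upsilon> :: "nat \<Rightarrow> nat \<Rightarrow> nat \<Rightarrow> complex"  \<comment> \<open>\<open>\<Upsilon> r p s\<close> has lower indices \<open>r, p\<close> and upper index \<open>s\<close>\<close>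
  assumes scale_mult_left: "scale c (a * b) = scale c a * b"
    and m_pos: "1 \<le> m"
    and m_le_n: "m \<le> n"
    and basis_inj: "inj_on I {1..n}"
    and basis_independent: "independent (I ` {1..n})"
    and basis_span: "span (I ` {1..n}) = UNIV"
    and idempotents:
      "\<And>r s. r \<in> {1..m} \<Longrightarrow> s \<in> {1..m} \<Longrightarrow> I r * I s = (if r = s then I r else 0)"
    and nilpotents:
      "\<And>r s. r \<in> {m+1..n} \<Longrightarrow> s \<in> {m+1..n} \<Longrightarrow>
         I r * I s = (\<Sum>p = max r s + 1..n. scale (\<Upsilon> r p s) (I p))"
    and idempotent_nilpotent:
      "\<And>s. s \<in> {m+1..n} \<Longrightarrow>
         \<exists>!u. u \<in> {1..m} \<and> (\<forall>r\<in>{1..m}. I r * I s = (if r = u then I s else 0))"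
    and one_eq: "1 = (\<Sum>u = 1..m. I u)"
begin

definition coord :: "nat \<Rightarrow> 'a \<Rightarrow> complex" where
  "coord r a = representation (I ` {1..n}) a (I r)"

definition alg_norm :: "'a \<Rightarrow> real" where
  "alg_norm a = sqrt (\<Sum>r = 1..n. (cmod (coord r a))\<^sup>2)"

text \<open>Convergence in the usual topology of the finite-dimensional space \<open>'a\<close>.\<close>

definition alg_tendsto :: "('b \<Rightarrow> 'a) \<Rightarrow> 'a \<Rightarrow> 'b filter \<Rightarrow> bool" where
  "alg_tendsto F l \<F> \<longleftrightarrow> ((\<lambda>x. alg_norm (F x - l)) \<longlongrightarrow> 0) \<F>"

text \<open>\<open>f u\<close> is the linear functional with value \<open>1\<close> at \<open>I u\<close> and \<open>0\<close> at the other basis vectors.\<close>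

definition is_f :: "nat \<Rightarrow> ('a \<Rightarrow> complex) \<Rightarrow> bool" where
  "is_f u \<phi> \<longleftrightarrow> Vector_Spaces.linear scale (*) \<phi> \<and> \<phi> (I u) = 1 \<and> (\<forall>r\<in>{1..n} - {u}. \<phi> (I r) = 0)"

definition f :: "nat \<Rightarrow> 'a \<Rightarrow> complex" where
  "f u = (THE \<phi>. is_f u \<phi>)"

lemma coord_basis:
  assumes "r \<in> {1..n}" "s \<in> {1..n}"
  shows "coord r (I s) = (if r = s then 1 else 0)"
  using assms basis_inj
  by (auto simp: coord_def representation_basis[OF basis_independent] inj_on_eq_iff simp del: One_nat_def)

lemma is_f_coord:
  assumes "u \<in> {1..n}"
  shows "is_f u (coord u)"
proof -
  interpret C: vector_space "(*) :: complex \<Rightarrow> complex \<Rightarrow> complex"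
    by unfold_locales (auto simp: algebra_simps)
  have "Vector_Spaces.linear scale (*) (coord u)"
  proof unfold_locales
    show "coord u (b1 + b2) = coord u b1 + coord u b2" for b1 b2
      by (simp add: coord_def representation_add[OF basis_independent] basis_span del: One_nat_def)
    show "coord u (scale c b) = c * coord u b" for c b
      by (simp add: coord_def representation_scale[OF basis_independent] basis_span del: One_nat_def)
  qed
  then show ?thesis
    using assms by (auto simp: is_f_def coord_basis)
qed

lemma is_f_unique:
  assumes "is_f u \<phi>" "is_f u \<psi>"
  shows "\<phi> = \<psi>"
proof -
  interpret C: vector_space "(*) :: complex \<Rightarrow> complex \<Rightarrow> complex"
    by unfold_locales (auto simp: algebra_simps)
  interpret P: vector_space_pair scale "(*) :: complex \<Rightarrow> complex \<Rightarrow> complex" ..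
  have "\<phi> a = \<psi> a" for a
  proof (rule P.linear_eq_on[where B = "I ` {1..n}"])
    show "Vector_Spaces.linear scale (*) \<phi>" "Vector_Spaces.linear scale (*) \<psi>"
      using assms by (simp_all add: is_f_def)
    show "a \<in> span (I ` {1..n})"
      by (simp add: basis_span del: One_nat_def)
    fix b assume "b \<in> I ` {1..n}"
    then obtain r where "r \<in> {1..n}" "b = I r" by blast
    then show "\<phi> b = \<psi> b"
      using assms by (cases "r = u") (simp_all add: is_f_def)
  qed
  then show ?thesis by auto
qed

lemma f_eq_coord: "u \<in> {1..n} \<Longrightarrow> f u = coord u"
  unfolding f_def using is_f_coord is_f_unique by blast

end


section \<open>The subspace, monogenic functions, and the curvilinear integral\<close>

sublocale cartan_algebra \<subseteq> Real: vector_space "\<lambda>x. scale (complex_of_real x)"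
  by unfold_locales (simp_all add: scale_right_distrib scale_left_distrib)

context cartan_algebra
begin

text \<open>The coordinate indices are the elements of the finite type \<open>'k\<close>; \<open>point e x\<close> is the point
  with coordinate vector \<open>x\<close>.\<close>

definition point :: "('k::finite \<Rightarrow> 'a) \<Rightarrow> real ^ 'k \<Rightarrow> 'a" where
  "point e x = (\<Sum>j\<in>UNIV. scale (complex_of_real (x $ j)) (e j))"

definition E :: "('k::finite \<Rightarrow> 'a) \<Rightarrow> 'a set" where
  "E e = range (point e)"

definition real_set :: "('k::finite \<Rightarrow> 'a) \<Rightarrow> 'a set \<Rightarrow> (real ^ 'k) set" where
  "real_set e Q = {x. point e x \<in> Q}"

definition is_domain :: "('k::finite \<Rightarrow> 'a) \<Rightarrow> 'a set \<Rightarrow> bool" where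
  "is_domain e \<Omega> \<longleftrightarrow> \<Omega> \<subseteq> E e \<and> \<Omega> \<noteq> {} \<and> open (real_set e \<Omega>) \<and> connected (real_set e \<Omega>)"

definition alg_continuous_on :: "('k::finite \<Rightarrow> 'a) \<Rightarrow> 'a set \<Rightarrow> ('a \<Rightarrow> 'a) \<Rightarrow> bool" where
  "alg_continuous_on e Q \<Psi> \<longleftrightarrow>
     (\<forall>x\<in>real_set e Q. alg_tendsto (\<lambda>y. \<Psi> (point e y)) (\<Psi> (point e x)) (at x within real_set e Q))"

text \<open>A function on \<open>\<Omega>\<close> is a total function whose values outside \<open>\<Omega>\<close> are irrelevant: in a domain,
  \<open>\<zeta> + \<epsilon>h\<close> belongs to \<open>\<Omega>\<close> for all small \<open>\<epsilon>\<close>.\<close>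

definition monogenic_on :: "('k::finite \<Rightarrow> 'a) \<Rightarrow> 'a set \<Rightarrow> ('a \<Rightarrow> 'a) \<Rightarrow> bool" where
  "monogenic_on e \<Omega> \<Phi> \<longleftrightarrow> alg_continuous_on e \<Omega> \<Phi> \<and>
     (\<forall>\<zeta>\<in>\<Omega>. \<exists>\<Phi>'. \<forall>h\<in>E e.
        alg_tendsto
          (\<lambda>\<epsilon>::real. scale (complex_of_real (inverse \<epsilon>)) (\<Phi> (\<zeta> + scale (complex_of_real \<epsilon>) h) - \<Phi> \<zeta>))
          (h * \<Phi>') (at_right 0))"

text \<open>A curve in the subspace is given by a parametrization of its image in the coordinate space.\<close>

definition homotopic_to_point :: "('k::finite \<Rightarrow> 'a) \<Rightarrow> 'a set \<Rightarrow> (real \<Rightarrow> real ^ 'k) \<Rightarrow> bool" where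
  "homotopic_to_point e \<Omega> \<gamma> \<longleftrightarrow> (\<exists>a. homotopic_loops (real_set e \<Omega>) \<gamma> (\<lambda>t. a))"

definition alg_integral :: "('k::finite \<Rightarrow> 'a) \<Rightarrow> (real \<Rightarrow> real ^ 'k) \<Rightarrow> ('a \<Rightarrow> 'a) \<Rightarrow> 'a" where
  "alg_integral e \<gamma> \<Psi> =
     (\<Sum>j\<in>UNIV. e j * (\<Sum>r = 1..n.
        scale (complex_of_real (line_integral (\<lambda>x. Re (coord r (\<Psi> (point e x)))) \<gamma> j)) (I r)))
     + scale \<i> (\<Sum>j\<in>UNIV. e j * (\<Sum>r = 1..n.
        scale (complex_of_real (line_integral (\<lambda>x. Im (coord r (\<Psi> (point e x)))) \<gamma> j)) (I r)))"

end

text \<open>\<open>j1\<close> is the index of the vector that is the unit of the algebra. Injectivity together with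
  independence of the range is linear independence over the reals of the family \<open>e\<close>.\<close>

locale cartan_subspace = cartan_algebra scale n m I \<Upsilon>
  for scale :: "complex \<Rightarrow> 'a::comm_ring_1 \<Rightarrow> 'a" and n m I \<Upsilon> +
  fixes e :: "'k::finite \<Rightarrow> 'a"
    and j1 :: 'k
  assumes k_ge_2: "2 \<le> CARD('k)"
    and k_le_2n: "CARD('k) \<le> 2 * n"
    and e_one: "e j1 = 1"
    and e_inj: "inj e"
    and e_independent: "Real.independent (range e)"
    and f_surj: "\<And>u. u \<in> {1..m} \<Longrightarrow> f u ` E e = UNIV"

end

theory Submission
  imports Defs "HOL-Complex_Analysis.Complex_Analysis" "HOL-Real_Asymp.Real_Asymp"
begin

text \<open>
  The form \<open>\<Phi>(\<zeta>) d\<zeta>\<close> would obviously be closed if \<open>\<Phi>\<close> were continuously differentiable: its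
  coefficients are \<open>e j * \<Phi>\<close> and the partial derivatives of \<open>\<Phi>\<close> are \<open>e j * \<Phi>'\<close>. But a monogenic function
  is only assumed to be continuous with limits along rays, so regularity is the
  heart of the matter. The proof shows that \<open>\<Phi>\<close> has a primitive on every ball
  (\<open>monogenic_has_primitive\<close>), and then that the integral of a locally exact form along a rectifiable
  null-homotopic loop is zero (\<open>locally_exact_line_integral_eq_0\<close>).

  The primitive is found one basis vector at a time. Multiplication is triangular in the Cartan basis:
  if the coordinates of \<open>\<Phi>\<close> with index below \<open>s\<close> vanish, then its coordinate with index \<open>s\<close> has the derivative
  \<open>f\<^sub>u(h) c\<close> in every direction \<open>h\<close>, for \<open>u = component s\<close> and some complex number \<open>c\<close>. Such a function
  is constant along the kernel of \<open>f\<^sub>u\<close>, and because \<open>f\<^sub>u\<close> maps the subspace onto the plane it equals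
  \<open>G(f\<^sub>u(\<zeta>))\<close> for a function \<open>G\<close> on a planar domain that has complex linear
  derivatives along all rays. The theorem \<open>directionally_differentiable_imp_holomorphic\<close> says that \<open>G\<close> is
  holomorphic. The Taylor expansion of \<open>G\<close> in the nilpotent part of \<open>\<zeta>\<close> extends \<open>I s * G(f\<^sub>u(\<zeta>))\<close> to a monogenic
  function with an evident primitive; subtracting it from \<open>\<Phi>\<close> kills the coordinate \<open>s\<close>, and
  the argument is repeated.

  Holomorphy of \<open>G\<close> comes from Baire's theorem and the Phragmen--Lindelof principle
  (\<open>quotient_bound_slit_ball\<close>). On a piece of the set of non-analytic points the
  difference quotients along the axes are bounded; the maximum principle, applied on a disc cut along a ray
  on which the quotient is bounded too, extends the bound to all directions. So \<open>G\<close> is Lipschitz near a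
  point of that set, and a Lipschitz function with complex linear directional derivatives is complex differentiable.

  The vanishing of the integral is a statement about Riemann--Stieltjes sums, since the
  curve has no derivative to integrate. Pulled back along a homotopy, the increments of local primitives
  fit together to one function on the unit square (\<open>cocycle_on_convex_is_coboundary\<close>).
\<close>

section \<open>A Phragmen--Lindelof estimate for difference quotients\<close>

text \<open>Below, the function jumps across a slit, so it has no continuous extension to the frontier; but only
  upper limits of its modulus matter. For \<open>C > K\<close> the region where the modulus exceeds \<open>C\<close> stays away
  from the frontier of \<open>U\<close>, and the modulus equals \<open>C\<close> on the frontier of that region.\<close>

lemma maximum_modulus_limsup_frontier:
  fixes h :: "complex \<Rightarrow> complex"
  assumes "open U" "bounded U" and hol: "h holomorphic_on U"
    and bdry: "\<And>\<xi> C. \<xi> \<in> frontier U \<Longrightarrow> K < C \<Longrightarrow> \<forall>\<^sub>F z in at \<xi> within U. norm (h z) \<le> C"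
    and "z \<in> U"
  shows "norm (h z) \<le> K"
proof (rule ccontr)
  assume "\<not> norm (h z) \<le> K"
  then obtain C where C: "K < C" "C < norm (h z)"
    using dense[of K "norm (h z)"] by auto
  define V where "V = {w\<in>U. C < norm (h w)}"
  have conth: "continuous_on U h"
    using hol by (rule holomorphic_on_imp_continuous_on)
  have "open V"
  proof -
    have "openin (top_of_set U) (U \<inter> (\<lambda>w. norm (h w)) -` {C<..})"
      by (intro continuous_openin_preimage_gen continuous_on_norm conth) auto
    moreover have "U \<inter> (\<lambda>w. norm (h w)) -` {C<..} = V"
      by (auto simp: V_def)
    ultimately show ?thesis
      using \<open>open U\<close> openin_open_trans by metis
  qed
  have "closure V \<subseteq> U"
  proof
    fix \<xi> assume \<xi>: "\<xi> \<in> closure V"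
    show "\<xi> \<in> U"
    proof (rule ccontr)
      assume "\<xi> \<notin> U"
      moreover have "\<xi> \<in> closure U"
        using \<xi> closure_mono[of V U] by (auto simp: V_def)
      ultimately have "\<xi> \<in> frontier U"
        using \<open>open U\<close> by (simp add: frontier_def interior_open)
      from bdry[OF this C(1)] obtain S where S: "open S" "\<xi> \<in> S"
          "\<And>x. x \<in> S \<Longrightarrow> x \<noteq> \<xi> \<Longrightarrow> x \<in> U \<Longrightarrow> norm (h x) \<le> C"
        unfolding eventually_at_topological by auto
      obtain x where "x \<in> S" "x \<in> V"
        using \<xi> S(1,2) by (metis closure_iff_nhds_not_empty disjoint_iff order_refl)
      then show False
        using S(3)[of x] \<open>\<xi> \<notin> U\<close> by (auto simp: V_def)
    qed
  qed
  have "norm (h z) \<le> C"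
  proof (rule maximum_modulus_frontier[of h V])
    show "h holomorphic_on interior V"
      using hol by (rule holomorphic_on_subset) (use interior_subset in \<open>auto simp: V_def\<close>)
    show "continuous_on (closure V) h"
      using conth \<open>closure V \<subseteq> U\<close> by (rule continuous_on_subset)
    show "bounded V"
      using \<open>bounded U\<close> by (rule bounded_subset) (auto simp: V_def)
    show "z \<in> V"
      using \<open>z \<in> U\<close> C by (simp add: V_def)
    fix w assume "w \<in> frontier V"
    then have "w \<in> closure V" "w \<notin> V"
      using \<open>open V\<close> by (auto simp: frontier_def interior_open)
    then show "norm (h w) \<le> C"
      using \<open>closure V \<subseteq> U\<close> by (auto simp: V_def)
  qed
  then show False using C by simp
qed

text \<open>The argument of \<open>z powr (-1/4)\<close> lies between \<open>-\<pi>/4\<close> and \<open>\<pi>/4\<close>. Hence \<open>exp (-\<epsilon> * z powr (-1/4))\<close> has modulus at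
  most \<open>1\<close> and tends to \<open>0\<close> at the origin faster than every power, uniformly up to the slit.\<close>

lemma Re_powr_neg_quarter:
  assumes "z \<noteq> 0"
  shows "Re (z powr (-1/4)) \<ge> norm z powr (-1/4) / sqrt 2"
proof -
  have "Re (z powr (-1/4)) = exp (Re (-1/4 * Ln z)) * cos (Im (-1/4 * Ln z))"
    using assms by (simp add: powr_def Re_exp)
  also have "exp (Re (-1/4 * Ln z)) = norm z powr (-1/4)"
    using assms by (simp add: powr_def)
  also have "cos (Im (-1/4 * Ln z)) = cos \<bar>Im (Ln z) / 4\<bar>"
    by (simp only: cos_abs_real) simp
  finally have eq: "Re (z powr (-1/4)) = norm z powr (-1/4) * cos \<bar>Im (Ln z) / 4\<bar>" .
  have "\<bar>Im (Ln z) / 4\<bar> \<le> pi / 4"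
    using Im_Ln_le_pi[OF assms] mpi_less_Im_Ln[OF assms] by auto
  then have "cos (pi/4) \<le> cos \<bar>Im (Ln z) / 4\<bar>"
    by (intro cos_monotone_0_pi_le) auto
  then have "1 / sqrt 2 \<le> cos \<bar>Im (Ln z) / 4\<bar>"
  proof -
    have "1 / sqrt 2 = sqrt 2 / 2" by (simp add: field_simps)
    then show ?thesis using \<open>cos (pi/4) \<le> cos \<bar>Im (Ln z) / 4\<bar>\<close> by (simp add: cos_45)
  qed
  then show ?thesis
    unfolding eq using mult_left_mono[of "1 / sqrt 2" "cos \<bar>Im (Ln z) / 4\<bar>" "norm z powr (-1/4)"] by simp
qed

text \<open>A Phragmen--Lindelof argument. The difference quotient \<open>q\<close> of \<open>G\<close> at \<open>w\<close> is holomorphic on the ball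
  minus \<open>E\<close> and minus the slit \<open>T\<close>, and it is bounded by \<open>K\<close> on the frontier of that set except at \<open>w\<close>,
  where only \<open>q = O(1 / \<bar>z - w\<bar>)\<close> is known. The factor \<open>exp (-\<epsilon> * (z - w) powr (-1/4))\<close> removes the
  exceptional point; it exists because the slit makes a branch of the fourth root available. Then \<open>\<epsilon>\<close>
  tends to \<open>0\<close>.\<close>

lemma quotient_bound_slit_ball:
  fixes G :: "complex \<Rightarrow> complex"
  assumes "0 < r" "closed E"
    and cont: "continuous_on (cball w r) G"
    and hol: "G holomorphic_on (ball w r - E)"
    and onE: "\<And>z. z \<in> E \<inter> cball w r \<Longrightarrow> norm (G z - G w) \<le> K * norm (z - w)"
    and slit: "\<And>t::real. 0 \<le> t \<Longrightarrow> t \<le> r \<Longrightarrow> norm (G (w - t) - G w) \<le> K * t"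
    and sph: "\<And>z. norm (z - w) = r \<Longrightarrow> norm (G z - G w) \<le> K * r"
    and "z \<in> cball w r"
  shows "norm (G z - G w) \<le> K * norm (z - w)"
proof -
  define T where "T = {w - complex_of_real t |t. 0 \<le> t}"
  define U where "U = ball w r - (E \<union> T)"
  define q where "q z = (G z - G w) / (z - w)" for z
  have T_eq: "T = (\<lambda>z. z - w) -` \<real>\<^sub>\<le>\<^sub>0"
  proof -
    have "z \<in> T \<longleftrightarrow> z - w \<in> \<real>\<^sub>\<le>\<^sub>0" for z
    proof
      assume "z - w \<in> \<real>\<^sub>\<le>\<^sub>0"
      then obtain t where "z - w = of_real t" "t \<le> 0"
        by (auto elim!: nonpos_Reals_cases)
      then have "z = w - of_real (-t) \<and> 0 \<le> -t"
        by (simp add: algebra_simps)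
      then show "z \<in> T" unfolding T_def by blast
    qed (auto simp: T_def)
    then show ?thesis by auto
  qed
  have "closed T"
    unfolding T_eq by (intro continuous_closed_vimage closed_nonpos_Reals_complex) auto
  have "w \<in> T" unfolding T_eq by simp
  have "open U"
    unfolding U_def using \<open>closed T\<close> \<open>closed E\<close> by (intro open_Diff closed_Un) auto
  have U_sub: "U \<subseteq> cball w r" by (auto simp: U_def)
  have K0: "0 \<le> K"
  proof -
    have "0 \<le> K * r" using slit[of r] \<open>0 < r\<close> by (meson norm_ge_zero order.trans less_imp_le order_refl)
    then show ?thesis using \<open>0 < r\<close> by (simp add: zero_le_mult_iff)
  qed
  have other: "norm (G z - G w) \<le> K * norm (z - w)" if zU: "z \<in> cball w r" "z \<notin> U" for z
  proof -
    have "dist w z = norm (z - w)" by (simp add: dist_norm norm_minus_commute)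
    then consider "norm (z - w) = r" | "z \<in> E" | "z \<in> T"
      using zU by (auto simp: U_def order_le_less)
    then show ?thesis
    proof cases
      case 3
      then obtain t where t: "z = w - complex_of_real t" "0 \<le> t" by (auto simp: T_def)
      then have "t \<le> r" using zU(1) by (simp add: dist_norm)
      with slit[of t] t show ?thesis by simp
    qed (use zU onE sph in auto)
  qed
  have contq: "continuous_on (cball w r - {w}) q"
    unfolding q_def by (intro continuous_intros continuous_on_subset[OF cont]) auto
  have bound_eps: "norm (q z * exp (- of_real \<epsilon> * (z - w) powr (-1/4))) \<le> K"
    if "\<epsilon> > 0" "z \<in> U" for \<epsilon> z
  proof (rule maximum_modulus_limsup_frontier[where U = U and z = z and
        h = "\<lambda>z. q z * exp (- of_real \<epsilon> * (z - w) powr (-1/4))"])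
    show "open U" "z \<in> U" by fact+
    show "bounded U" by (rule bounded_subset[of "ball w r"]) (auto simp: U_def)
    show "(\<lambda>z. q z * exp (- of_real \<epsilon> * (z - w) powr (-1/4))) holomorphic_on U"
      unfolding q_def using \<open>w \<in> T\<close>
      by (intro holomorphic_intros holomorphic_on_subset[OF hol]) (auto simp: U_def T_eq)
    fix \<xi> C assume \<xi>: "\<xi> \<in> frontier U" and C: "K < C"
    have notU: "\<xi> \<notin> U" "\<xi> \<in> closure U"
      using \<xi> \<open>open U\<close> by (auto simp: frontier_def interior_open)
    then have "\<xi> \<in> cball w r"
      using closure_mono[of U "cball w r"] U_sub by auto
    have ex: "norm (exp (- of_real \<epsilon> * (z - w) powr (-1/4))) \<le> exp (- \<epsilon> / sqrt 2 * norm (z - w) powr (-1/4))"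
      if "z \<in> U" for z
    proof -
      have "z - w \<noteq> 0" using that \<open>w \<in> T\<close> by (auto simp: U_def)
      from Re_powr_neg_quarter[OF this] \<open>\<epsilon> > 0\<close> show ?thesis
        by (simp add: field_simps)
    qed
    show "\<forall>\<^sub>F z in at \<xi> within U. norm (q z * exp (- of_real \<epsilon> * (z - w) powr (-1/4))) \<le> C"
    proof (cases "\<xi> = w")
      case False
      have "(q \<longlongrightarrow> q \<xi>) (at \<xi> within cball w r - {w})"
        using contq False \<open>\<xi> \<in> cball w r\<close> by (auto simp: continuous_on_def)
      then have "((\<lambda>z. norm (q z)) \<longlongrightarrow> norm (q \<xi>)) (at \<xi> within U)"
        by (intro tendsto_norm) (erule tendsto_within_subset, use \<open>w \<in> T\<close> in \<open>auto simp: U_def\<close>)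
      moreover have "norm (q \<xi>) \<le> K"
        using other[OF \<open>\<xi> \<in> cball w r\<close> notU(1)] False by (simp add: q_def norm_divide field_simps)
      ultimately have "\<forall>\<^sub>F z in at \<xi> within U. norm (q z) < C"
        using C by (intro order_tendstoD(2)[of _ "norm (q \<xi>)"]) auto
      moreover have "\<forall>\<^sub>F z in at \<xi> within U. z \<in> U"
        by (simp add: eventually_at_filter)
      ultimately show ?thesis
      proof eventually_elim
        case (elim z)
        have "exp (- \<epsilon> / sqrt 2 * norm (z - w) powr (-1/4)) \<le> 1"
          using \<open>\<epsilon> > 0\<close> by simp
        then have "norm (exp (- of_real \<epsilon> * (z - w) powr (-1/4))) \<le> 1"
          using ex[OF elim(2)] by linarith
        then have "norm (q z * exp (- of_real \<epsilon> * (z - w) powr (-1/4))) \<le> norm (q z) * 1"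
          unfolding norm_mult by (intro mult_left_mono) auto
        then show ?case using elim by simp
      qed
    next
      case True
      have "compact (G ` cball w r)"
        using cont by (intro compact_continuous_image) auto
      then have "bounded (G ` cball w r)" by (rule compact_imp_bounded)
  then obtain M where "\<forall>y\<in>G ` cball w r. norm y \<le> M" unfolding bounded_iff by blast
  then have M: "norm (G z) \<le> M" if "z \<in> cball w r" for z using that by blast
      have "((\<lambda>s. 2 * M / s * exp (- \<epsilon> / sqrt 2 * s powr (-1/4))) \<longlongrightarrow> 0) (at_right 0)"
        using \<open>\<epsilon> > 0\<close> by real_asymp
      moreover have "filterlim (\<lambda>z. norm (z - w)) (at_right 0) (at w within U)"
        unfolding filterlim_at
        by (auto simp: eventually_at_filter intro!: tendsto_eq_intros)
      ultimately have "((\<lambda>z. 2 * M / norm (z - w) * exp (- \<epsilon> / sqrt 2 * norm (z - w) powr (-1/4))) \<longlongrightarrow> 0) (at w within U)"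
        by (rule filterlim_compose)
      then have "\<forall>\<^sub>F z in at w within U. 2 * M / norm (z - w) * exp (- \<epsilon> / sqrt 2 * norm (z - w) powr (-1/4)) < C"
        using C K0 by (intro order_tendstoD(2)[of _ 0]) auto
      moreover have "\<forall>\<^sub>F z in at w within U. z \<in> U"
        by (simp add: eventually_at_filter)
      ultimately show ?thesis unfolding True
      proof eventually_elim
        case (elim z)
        have "z \<in> cball w r" using elim by (auto simp: U_def)
        have "norm (G z - G w) \<le> 2 * M"
          using norm_triangle_ineq4[of "G z" "G w"] M[OF \<open>z \<in> cball w r\<close>] M[of w] \<open>0 < r\<close> by simp
        then have "norm (q z) \<le> 2 * M / norm (z - w)"
          by (simp add: q_def norm_divide divide_right_mono)
        then have "norm (q z * exp (- of_real \<epsilon> * (z - w) powr (-1/4)))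
           \<le> 2 * M / norm (z - w) * exp (- \<epsilon> / sqrt 2 * norm (z - w) powr (-1/4))"
          unfolding norm_mult using ex[OF elim(2)] norm_ge_zero order_trans by (intro mult_mono) (auto, smt (verit) norm_ge_zero)
        then show ?case using elim by linarith
      qed
    qed
  qed
  show ?thesis
  proof (cases "z \<in> U")
    case True
    have "((\<lambda>\<epsilon>. norm (q z * exp (- of_real \<epsilon> * (z - w) powr (-1/4)))) \<longlongrightarrow> norm (q z * exp (- of_real 0 * (z - w) powr (-1/4)))) (at_right 0)"
      by (intro tendsto_intros)
    moreover have "\<forall>\<^sub>F \<epsilon> in at_right 0. norm (q z * exp (- of_real \<epsilon> * (z - w) powr (-1/4))) \<le> K"
      using bound_eps True by (auto simp: eventually_at_filter)
    ultimately have "norm (q z * exp (- of_real 0 * (z - w) powr (-1/4))) \<le> K"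
      by (intro tendsto_upperbound) auto
    moreover have "z \<noteq> w" using True \<open>w \<in> T\<close> by (auto simp: U_def)
    ultimately show ?thesis
      by (simp add: q_def norm_divide field_simps)
  qed (use other assms in auto)
qed

section \<open>Holomorphy from complex linear derivatives along rays\<close>

text \<open>The category theorem in the form used below: uniformity on a relatively open piece of \<open>S\<close>.\<close>

lemma Baire_closed_cover:
  fixes S :: "'a::{real_normed_vector,heine_borel} set" and A :: "nat \<Rightarrow> 'a set"
  assumes "closed S" "S \<noteq> {}" and cl: "\<And>n. closed (A n)" and cover: "S \<subseteq> (\<Union>n. A n)"
  obtains n W where "open W" "W \<inter> S \<noteq> {}" "W \<inter> S \<subseteq> A n"
proof (rule ccontr)
  assume *: "\<not> thesis"
  have "S \<subseteq> closure (\<Inter>(range (\<lambda>n. S - A n)))"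
  proof (rule Baire[OF \<open>closed S\<close>])
    fix T assume "T \<in> range (\<lambda>n. S - A n)"
    then obtain n where n: "T = S - A n" by auto
    have "openin (top_of_set S) T"
      unfolding n using cl[of n] by (metis Diff_eq openin_open_Int open_Compl)
    moreover have "S \<subseteq> closure T"
    proof
      fix x assume "x \<in> S"
      show "x \<in> closure T"
        unfolding closure_iff_nhds_not_empty
      proof (intro allI impI)
        fix B V assume "V \<subseteq> B" "open V" "x \<in> V"
        then have "V \<inter> S \<noteq> {}" using \<open>x \<in> S\<close> by auto
        with that[OF \<open>open V\<close>, of n] * have "\<not> V \<inter> S \<subseteq> A n" by blast
        then show "T \<inter> B \<noteq> {}" using \<open>V \<subseteq> B\<close> n by blast
      qed
    qed
    ultimately show "openin (top_of_set S) T \<and> S \<subseteq> closure T" by simp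
  qed auto
  moreover have "\<Inter>(range (\<lambda>n. S - A n)) = {}" using cover by auto
  ultimately have "S \<subseteq> closure {}" by (simp only:)
  then show False using \<open>S \<noteq> {}\<close> by simp
qed

lemma directional_limit_bounded:
  fixes G :: "complex \<Rightarrow> complex"
  assumes "((\<lambda>t::real. (G (z + of_real t * w) - G z) / of_real t) \<longlongrightarrow> l) (at_right 0)"
  obtains d C where "0 < d" "\<And>t. 0 \<le> t \<Longrightarrow> t < d \<Longrightarrow> norm (G (z + of_real t * w) - G z) \<le> C * t"
proof -
  have "((\<lambda>t::real. norm ((G (z + of_real t * w) - G z) / of_real t)) \<longlongrightarrow> norm l) (at_right 0)"
    using assms by (rule tendsto_norm)
  then have "\<forall>\<^sub>F t in at_right 0. norm ((G (z + of_real t * w) - G z) / of_real t) < norm l + 1"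
    by (rule order_tendstoD(2)) simp
  then obtain d where d: "d > 0" "\<And>t. 0 < t \<Longrightarrow> t < d \<Longrightarrow> norm ((G (z + of_real t * w) - G z) / of_real t) < norm l + 1"
    by (auto simp: eventually_at_right_field)
  show thesis
  proof (rule that[OF d(1)])
    fix t assume "0 \<le> t" "t < d"
    then show "norm (G (z + of_real t * w) - G z) \<le> (norm l + 1) * t"
      using d(2)[of t] by (cases "t = 0") (auto simp: norm_divide field_simps)
  qed
qed

text \<open>Finitely many unit vectors \<open>N\<close> are \<open>\<eta>\<close>-dense in the unit circle. The directional limits are uniform on
  \<open>N\<close>, and the Lipschitz bound carries them over to all directions.\<close>

lemma Lipschitz_Gateaux_imp_field_derivative:
  fixes G :: "complex \<Rightarrow> complex"
  assumes "0 < r"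
    and lip: "\<And>x y. x \<in> ball z r \<Longrightarrow> y \<in> ball z r \<Longrightarrow> norm (G x - G y) \<le> K * norm (x - y)"
    and dir: "\<And>w. ((\<lambda>t::real. (G (z + of_real t * w) - G z) / of_real t) \<longlongrightarrow> w * c) (at_right 0)"
  shows "(G has_field_derivative c) (at z)"
proof -
  have K0: "0 \<le> K"
  proof -
    have "0 \<le> K * norm (z - (z + of_real (r/2)))"
      using lip[of z "z + of_real (r/2)"] \<open>0 < r\<close>
      by (intro order_trans[OF norm_ge_zero lip]) (auto simp: dist_norm)
    then show ?thesis
      using \<open>0 < r\<close> by (simp add: zero_le_mult_iff)
  qed
  show ?thesis
    unfolding has_field_derivative_iff LIM_eq
  proof (intro allI impI)
    fix \<epsilon> :: real assume "0 < \<epsilon>"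
    define \<eta> where "\<eta> = \<epsilon> / 2 / (K + norm c + 1)"
    have pos: "0 < K + norm c + 1" using K0 norm_ge_zero[of c] by linarith
    have "0 < \<eta>" using \<open>0 < \<epsilon>\<close> K0 by (auto simp: \<eta>_def intro!: divide_pos_pos add_nonneg_pos)
    have "compact (sphere 0 1 :: complex set)" by simp
    then obtain N where N: "finite N" "N \<subseteq> sphere 0 1" "sphere 0 (1::real) \<subseteq> (\<Union>x\<in>N. ball x \<eta> :: complex set)"
      using compactE_image[of "sphere 0 1 :: complex set" "sphere 0 1" "\<lambda>x. ball x \<eta>"] \<open>0 < \<eta>\<close>
      by (metis (no_types, lifting) UN_I centre_in_ball open_ball subsetI)
    have "\<forall>\<^sub>F t in at_right 0. \<forall>w\<in>N. norm ((G (z + of_real t * w) - G z) / of_real t - w * c) < \<epsilon> / 2"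
      unfolding eventually_ball_finite_distrib[OF N(1)]
      using tendstoD[OF dir, of "\<epsilon>/2"] \<open>0 < \<epsilon>\<close> by (auto simp: dist_norm)
    then obtain d where d: "d > 0" "\<And>t w. 0 < t \<Longrightarrow> t < d \<Longrightarrow> w \<in> N \<Longrightarrow>
        norm ((G (z + of_real t * w) - G z) / of_real t - w * c) < \<epsilon> / 2"
      by (auto simp: eventually_at_right_field)
    show "\<exists>s>0. \<forall>x. x \<noteq> z \<and> norm (x - z) < s \<longrightarrow> norm ((G x - G z) / (x - z) - c) < \<epsilon>"
    proof (intro exI[of _ "min d r"] conjI allI impI)
      fix x assume x: "x \<noteq> z \<and> norm (x - z) < min d r"
      define t where "t = norm (x - z)"
      define v where "v = (x - z) / of_real t"
      have t: "0 < t" "t < d" "t < r" using x by (auto simp: t_def)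
      have v: "norm v = 1" "x = z + of_real t * v"
        using t by (auto simp: v_def t_def norm_divide)
      then obtain w where w: "w \<in> N" "norm (v - w) < \<eta>"
        using N(3) by (force simp: dist_norm norm_minus_commute)
      have nw: "norm w = 1" using w N(2) by auto
      have "norm (G x - G (z + of_real t * w)) \<le> K * norm (x - (z + of_real t * w))"
        using t by (intro lip) (auto simp: dist_norm v norm_mult nw)
      also have "x - (z + of_real t * w) = of_real t * (v - w)"
        by (simp add: v algebra_simps)
      also have "K * norm (of_real t * (v - w)) \<le> K * (t * \<eta>)"
        using t w K0 by (auto simp: norm_mult intro!: mult_left_mono)
      finally have 1: "norm ((G x - G (z + of_real t * w)) / of_real t) \<le> K * \<eta>"
        using t by (simp add: norm_divide field_simps)
      have 2: "norm ((G (z + of_real t * w) - G z) / of_real t - w * c) < \<epsilon> / 2"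
        using d(2) t w by auto
      have 3: "norm ((w - v) * c) \<le> \<eta> * norm c"
        unfolding norm_mult using w by (intro mult_right_mono) (auto simp: norm_minus_commute)
      have "(G x - G z) / of_real t - v * c =
          (G x - G (z + of_real t * w)) / of_real t + ((G (z + of_real t * w) - G z) / of_real t - w * c) + (w - v) * c"
        by (simp add: diff_divide_distrib algebra_simps)
      then have "norm ((G x - G z) / of_real t - v * c) \<le> K * \<eta> + norm ((G (z + of_real t * w) - G z) / of_real t - w * c) + \<eta> * norm c"
        using 1 3 norm_triangle_mono[OF norm_triangle_mono[OF 1 order_refl] 3] by simp
      also have "\<dots> < K * \<eta> + \<epsilon> / 2 + \<eta> * norm c" using 2 by simp
      also have "\<dots> \<le> (K + norm c + 1) * \<eta> + \<epsilon> / 2" using \<open>0 < \<eta>\<close> by (simp add: algebra_simps)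
      also have "(K + norm c + 1) * \<eta> = \<epsilon> / 2"
        unfolding \<eta>_def using pos
        by (subst times_divide_eq_right, subst nonzero_mult_div_cancel_left) auto
      finally have *: "norm ((G x - G z) / of_real t - v * c) < \<epsilon>" by simp
      have "(G x - G z) / (x - z) - c = ((G x - G z) / of_real t - v * c) / v"
      proof -
        have "x - z = of_real t * v" "v \<noteq> 0" using t v by auto
        then show ?thesis using t by (simp add: divide_simps mult.commute)
      qed
      then show "norm ((G x - G z) / (x - z) - c) < \<epsilon>"
        using * v by (simp add: norm_divide)
    qed (use d \<open>0 < r\<close> in auto)
  qed
qed

text \<open>The horizontal line through \<open>z\<close> meets the vertical line through \<open>w\<close> in a point whose distance to each
  of them is at most \<open>\<bar>z - w\<bar>\<close>.\<close>

lemma crossing_axes_Lipschitz: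
  fixes G :: "complex \<Rightarrow> complex"
  assumes hor: "\<And>t. \<bar>t\<bar> \<le> d \<Longrightarrow> norm (G (z + of_real t) - G z) \<le> K * \<bar>t\<bar>"
    and ver: "\<And>t. \<bar>t\<bar> \<le> d \<Longrightarrow> norm (G (w + \<i> * of_real t) - G w) \<le> K * \<bar>t\<bar>"
    and "norm (z - w) \<le> d" "0 \<le> K"
  shows "norm (G z - G w) \<le> 2 * K * norm (z - w)"
proof -
  define s where "s = Re (w - z)"
  define t where "t = Im (z - w)"
  have st: "\<bar>s\<bar> \<le> norm (z - w)" "\<bar>t\<bar> \<le> norm (z - w)"
    unfolding s_def t_def using abs_Re_le_cmod[of "w - z"] abs_Im_le_cmod[of "z - w"]
    by (auto simp: norm_minus_commute)
  have eq: "z + of_real s = w + \<i> * of_real t"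
    by (simp add: complex_eq_iff s_def t_def)
  have "norm (G z - G w) \<le> norm (G (z + of_real s) - G z) + norm (G (w + \<i> * of_real t) - G w)"
    using norm_triangle_ineq4[of "G (w + \<i> * of_real t) - G w" "G (w + \<i> * of_real t) - G z"]
    unfolding eq by (simp add: algebra_simps)
  also have "\<dots> \<le> K * \<bar>s\<bar> + K * \<bar>t\<bar>"
    using assms st by (intro add_mono hor ver) auto
  also have "\<dots> \<le> K * norm (z - w) + K * norm (z - w)"
    using st \<open>0 \<le> K\<close> by (intro add_mono mult_left_mono) auto
  finally show ?thesis by simp
qed


text \<open>A relative of the Looman--Menchoff theorem, for functions that have a complex linear derivative
  along every ray but perhaps not uniformly in the direction of the ray. Let \<open>E\<close> be the set of points where \<open>G\<close>
  is not analytic, and suppose that it is nonempty. At each point the difference quotients along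
  the axes are bounded, so by Baire's theorem they are bounded by one constant \<open>N\<close> on a
  piece of \<open>E\<close>. Crossing axis lines shows that \<open>G\<close> is Lipschitz on this piece. Now
  \<open>quotient_bound_slit_ball\<close>, with a horizontal slit starting at a point \<open>w\<close> of the piece, bounds the
  difference quotient at \<open>w\<close> in all directions. Cauchy's inequality on the largest disc that misses
  \<open>E\<close> then bounds the derivative off \<open>E\<close>, and \<open>G\<close> is Lipschitz near a point of \<open>E\<close>.
  With the directional limits this makes \<open>G\<close> complex differentiable there, which contradicts the
  choice of \<open>E\<close>.\<close>

theorem directionally_differentiable_imp_holomorphic:
  fixes G :: "complex \<Rightarrow> complex"
  assumes "open D" and cont: "continuous_on D G"
    and dir: "\<And>z. z \<in> D \<Longrightarrow> \<exists>c. \<forall>w. ((\<lambda>t::real. (G (z + of_real t * w) - G z) / of_real t) \<longlongrightarrow> w * c) (at_right 0)"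
  shows "G holomorphic_on D"
proof (rule ccontr)
  assume nothol: "\<not> G holomorphic_on D"
  define E where "E = {z\<in>D. \<not> G analytic_on {z}}"
  have opA: "open {z. G analytic_on {z}}"
    unfolding open_subopen[of "{z. G analytic_on {z}}"]
    by (auto simp: analytic_at)
  have "E \<noteq> {}"
  proof
    assume "E = {}"
    then have "G analytic_on D" using analytic_on_analytic_at[of G D] by (auto simp: E_def)
    then show False using nothol analytic_imp_holomorphic by blast
  qed
  then obtain p where "p \<in> E" by blast
  then have "p \<in> D" by (simp add: E_def)
  then obtain r0 where r0: "0 < r0" "cball p r0 \<subseteq> D"
    using \<open>open D\<close> open_contains_cball by blast
  define r where "r = r0 / 2"
  have r: "0 < r" "cball p (2 * r) \<subseteq> D" using r0 by (auto simp: r_def)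
  define S where "S = closure (E \<inter> ball p r)"
  have "S \<subseteq> cball p r"
    unfolding S_def by (meson closed_cball closure_minimal inf.coboundedI2 ball_subset_cball)
  \<comment> \<open>Bound on the parameter \<open>t\<close> at stage \<open>n\<close>; it keeps the axis segments through points of \<open>S\<close> inside \<open>D\<close>.\<close>
  define dl where "dl n = r / (Suc n)" for n :: nat
  have dl: "0 < dl n" "dl n \<le> r" for n using r(1) by (auto simp: dl_def field_simps)
  define A where "A n = {z \<in> S. \<forall>t\<in>{- dl n..dl n}. norm (G (z + of_real t * 1) - G z) \<le> real n * \<bar>t\<bar>
      \<and> norm (G (z + of_real t * \<i>) - G z) \<le> real n * \<bar>t\<bar>}" for n
  have inD: "z + of_real t * w \<in> D" if "z \<in> S" "norm w = 1" "\<bar>t\<bar> \<le> r" for z t w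
  proof -
    have "dist p (z + of_real t * w) \<le> dist p z + dist z (z + of_real t * w)" by (rule dist_triangle)
    also have "\<dots> \<le> 2 * r" using that \<open>S \<subseteq> cball p r\<close> by (auto simp: dist_norm norm_mult)
    finally show ?thesis using r by auto
  qed
  have clA: "closed (A n)" for n
  proof -
    have cl: "closed {z\<in>S. norm (G (z + of_real t * w) - G z) \<le> C}" if "norm w = 1" "\<bar>t\<bar> \<le> r" for t w C
    proof -
      have "continuous_on S (\<lambda>z. norm (G (z + of_real t * w) - G (z + of_real 0 * w)))"
        using that r(1) by (intro continuous_intros continuous_on_compose2[OF cont]) (auto intro!: inD simp del: of_real_0)
      then have "closed (S \<inter> (\<lambda>z. norm (G (z + of_real t * w) - G (z + of_real 0 * w))) -` {..C})"
        by (intro continuous_closed_preimage) (auto simp: S_def)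
      also have "S \<inter> (\<lambda>z. norm (G (z + of_real t * w) - G (z + of_real 0 * w))) -` {..C} = {z\<in>S. norm (G (z + of_real t * w) - G z) \<le> C}"
        by auto
      finally show ?thesis .
    qed
    have "A n = (\<Inter>t\<in>{- dl n..dl n}. {z\<in>S. norm (G (z + of_real t * 1) - G z) \<le> real n * \<bar>t\<bar>}
        \<inter> {z\<in>S. norm (G (z + of_real t * \<i>) - G z) \<le> real n * \<bar>t\<bar>})"
      using dl(1)[of n] by (fastforce simp: A_def)
    also have "closed \<dots>"
      using dl(2)[of n] by (intro closed_INT ballI closed_Int cl) auto
    finally show ?thesis .
  qed
  have Sne: "S \<noteq> {}"
    using \<open>p \<in> E\<close> r(1) closure_subset[of "E \<inter> ball p r"] by (force simp: S_def)
  have cover: "S \<subseteq> (\<Union>n. A n)"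
  proof
    fix z assume "z \<in> S"
    then have "z \<in> D" using inD[of z 1 0] r(1) by simp
    then obtain c where c: "\<And>w. ((\<lambda>t::real. (G (z + of_real t * w) - G z) / of_real t) \<longlongrightarrow> w * c) (at_right 0)"
      using dir by blast
    have "\<exists>d C. 0 < d \<and> (\<forall>t. 0 \<le> t \<longrightarrow> t < d \<longrightarrow> norm (G (z + of_real t * w) - G z) \<le> C * t)" for w
      using directional_limit_bounded[OF c[of w]] by metis
    then obtain d C where dC: "\<And>w. 0 < d w" "\<And>w t. 0 \<le> t \<Longrightarrow> t < d w \<Longrightarrow> norm (G (z + of_real t * w) - G z) \<le> C w * t"
      by metis
    \<comment> \<open>The limits are one-sided, so both axes have to be traversed in both senses.\<close>
    define W where "W = {1, -1, \<i>, -\<i>}"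
    have fin: "finite (d ` W)" "finite (C ` W)" "d ` W \<noteq> {}" by (auto simp: W_def)
    have "\<forall>\<^sub>F n in sequentially. Max (C ` W) \<le> real n"
      using filterlim_real_sequentially by (auto simp: filterlim_at_top)
    moreover have "\<forall>\<^sub>F n in sequentially. dl n < Min (d ` W)"
    proof (rule order_tendstoD(2))
      show "dl \<longlonglongrightarrow> 0" unfolding dl_def by real_asymp
      show "0 < Min (d ` W)" using fin dC(1) by auto
    qed
    ultimately have "\<forall>\<^sub>F n in sequentially. Max (C ` W) \<le> real n \<and> dl n < Min (d ` W)"
      by (rule eventually_conj)
    then obtain n where n: "Max (C ` W) \<le> real n" "dl n < Min (d ` W)"
      using eventually_happens'[OF sequentially_bot] by blast
    have pos: "norm (G (z + of_real t * w) - G z) \<le> real n * t" if "w \<in> W" "0 \<le> t" "t \<le> dl n" for w t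
    proof -
      have "t < d w" using that n(2) Min_le[OF fin(1), of "d w"] by auto
      then have "norm (G (z + of_real t * w) - G z) \<le> C w * t" using dC(2) that by simp
      also have "\<dots> \<le> real n * t"
        using that n(1) Max_ge[OF fin(2), of "C w"] by (intro mult_right_mono) auto
      finally show ?thesis .
    qed
    have both: "norm (G (z + of_real t * w) - G z) \<le> real n * \<bar>t\<bar>" if "w \<in> {1, \<i>}" "t \<in> {- dl n..dl n}" for w t
    proof (cases "0 \<le> t")
      case True
      then show ?thesis using that pos[of w t] by (auto simp: W_def)
    next
      case False
      then show ?thesis using that pos[of "-w" "-t"] by (auto simp: W_def)
    qed
    have "z \<in> A n"
      using both[of 1] both[of "\<i>"] \<open>z \<in> S\<close> by (auto simp: A_def)
    then show "z \<in> (\<Union>n. A n)" by blast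
  qed
  have "closed S" by (simp add: S_def)
  from Baire_closed_cover[OF this Sne clA cover]
  obtain N W where NW: "open W" "W \<inter> S \<noteq> {}" "W \<inter> S \<subseteq> A N" .
  then have "W \<inter> (E \<inter> ball p r) \<noteq> {}"
    unfolding S_def by (metis disjoint_iff open_Int_closure_eq_empty)
  then obtain z0 where z0: "z0 \<in> W" "z0 \<in> E" "z0 \<in> ball p r" by blast
  have "open (W \<inter> ball p r \<inter> D)" using NW \<open>open D\<close> by auto
  moreover have "z0 \<in> W \<inter> ball p r \<inter> D" using z0 by (auto simp: E_def)
  ultimately obtain \<sigma>0 where \<sigma>0: "0 < \<sigma>0" "cball z0 \<sigma>0 \<subseteq> W \<inter> ball p r \<inter> D"
    using open_contains_cball by blast
  define \<rho> where "\<rho> = min (\<sigma>0 / 2) (dl N / 2)"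
  have \<rho>: "0 < \<rho>" "cball z0 (2 * \<rho>) \<subseteq> W \<inter> ball p r \<inter> D" "2 * \<rho> \<le> dl N"
    using \<sigma>0 dl(1)[of N] by (auto simp: \<rho>_def subset_iff)
  have axes: "norm (G (z + of_real t) - G z) \<le> real N * \<bar>t\<bar>" "norm (G (z + \<i> * of_real t) - G z) \<le> real N * \<bar>t\<bar>"
    if "z \<in> E" "z \<in> cball z0 (2 * \<rho>)" "\<bar>t\<bar> \<le> dl N" for z t
  proof -
    have "z \<in> W" "z \<in> ball p r" using subsetD[OF \<rho>(2) that(2)] by auto
    moreover have "z \<in> S"
      unfolding S_def using closure_subset[THEN subsetD, of z "E \<inter> ball p r"] that(1) \<open>z \<in> ball p r\<close> by blast
    ultimately have "z \<in> A N" using NW(3) by blast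
    then show "norm (G (z + of_real t) - G z) \<le> real N * \<bar>t\<bar>" "norm (G (z + \<i> * of_real t) - G z) \<le> real N * \<bar>t\<bar>"
      using that(3) by (auto simp: A_def mult.commute abs_le_iff)
  qed
  have lipE: "norm (G z - G w) \<le> 2 * real N * norm (z - w)"
    if "z \<in> E" "w \<in> E" "z \<in> cball z0 (2 * \<rho>)" "w \<in> cball z0 (2 * \<rho>)" "norm (z - w) \<le> dl N" for z w
    using that by (intro crossing_axes_Lipschitz[where d = "dl N"] axes) auto
  have contQ: "continuous_on (cball z0 (2 * \<rho>)) G"
    using cont by (rule continuous_on_subset) (use \<rho> in auto)
  then have "compact (G ` cball z0 (2 * \<rho>))"
    by (intro compact_continuous_image) auto
  then have "bounded (G ` cball z0 (2 * \<rho>))" by (rule compact_imp_bounded)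
  then obtain M where "\<forall>y\<in>G ` cball z0 (2 * \<rho>). norm y \<le> M" unfolding bounded_iff by blast
  then have M: "norm (G z) \<le> M" if "z \<in> cball z0 (2 * \<rho>)" for z using that by blast
  define K where "K = max (2 * real N) (2 * M / \<rho>)"
  have K: "2 * real N \<le> K" "2 * M / \<rho> \<le> K" "0 \<le> K" by (auto simp: K_def)
  define F where "F = E \<inter> cball z0 (2 * \<rho>)"
  have "closed F"
  proof -
    have "F = cball z0 (2 * \<rho>) - {z. G analytic_on {z}}"
      using \<rho> by (auto simp: F_def E_def)
    then show ?thesis using opA by auto
  qed
  have holF: "G holomorphic_on X" if X: "X \<subseteq> cball z0 (2 * \<rho>)" "X \<inter> F = {}" for X
  proof -
    have "G analytic_on {z}" if "z \<in> X" for z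
    proof -
      have "z \<in> cball z0 (2 * \<rho>)" "z \<notin> F" using \<open>z \<in> X\<close> that X by auto
      then show ?thesis using \<rho>(2) unfolding F_def E_def by blast
    qed
    then have "G analytic_on X" using analytic_on_analytic_at by blast
    then show ?thesis by (rule analytic_imp_holomorphic)
  qed
  \<comment> \<open>The main estimate: the quotient at a point \<open>w\<close> of \<open>E\<close> is bounded in every direction.\<close>
  have pt: "norm (G z - G w) \<le> K * norm (z - w)"
    if w: "w \<in> E" "w \<in> cball z0 \<rho>" and z: "z \<in> cball w \<rho>" for w z
  proof (rule quotient_bound_slit_ball[where r = \<rho> and E = F])
    have sub: "cball w \<rho> \<subseteq> cball z0 (2 * \<rho>)"
      using w(2) by (auto simp: cball_subset_cball_iff dist_commute)
    show "0 < \<rho>" "closed F" "z \<in> cball w \<rho>" by fact+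
    show "continuous_on (cball w \<rho>) G" using contQ sub by (rule continuous_on_subset)
    show "G holomorphic_on ball w \<rho> - F" using sub by (intro holF) auto
    show "norm (G z - G w) \<le> K * norm (z - w)" if z: "z \<in> F \<inter> cball w \<rho>" for z
    proof -
      have "norm (z - w) \<le> \<rho>" using z by (simp add: dist_norm norm_minus_commute)
      then have "norm (G z - G w) \<le> 2 * real N * norm (z - w)"
        using z w \<rho> by (intro lipE) (auto simp: F_def)
      also have "\<dots> \<le> K * norm (z - w)" using K by (intro mult_right_mono) auto
      finally show ?thesis .
    qed
    show "norm (G (w - complex_of_real t) - G w) \<le> K * t" if "0 \<le> t" "t \<le> \<rho>" for t
    proof -
      have "norm (G (w + complex_of_real (-t)) - G w) \<le> real N * \<bar>-t\<bar>"
        using w that \<rho> by (intro axes) auto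
      also have "\<dots> \<le> K * t" using K that by (auto intro!: mult_right_mono)
      finally show ?thesis by simp
    qed
    show "norm (G z - G w) \<le> K * \<rho>" if "norm (z - w) = \<rho>" for z
    proof -
      have "z \<in> cball z0 (2 * \<rho>)" "w \<in> cball z0 (2 * \<rho>)"
        using subsetD[OF sub, of z] subsetD[OF sub, of w] that \<rho>(1)
        by (auto simp: dist_norm norm_minus_commute)
      then have "norm (G z - G w) \<le> 2 * M"
        using norm_triangle_ineq4[of "G z" "G w"] M[of z] M[of w] by linarith
      also have "\<dots> \<le> K * \<rho>" using K(2) \<rho>(1) by (simp add: field_simps)
      finally show ?thesis .
    qed
  qed
  define B where "B = ball z0 (\<rho> / 4)"
  \<comment> \<open>The disc about \<open>z\<close> that reaches the nearest point \<open>w\<close> of \<open>E\<close> has all its points within \<open>2 * s\<close> of \<open>w\<close>.\<close>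
  have der: "norm (deriv G z) \<le> 2 * K" if z: "z \<in> B" "z \<notin> E" for z
  proof -
    have zb: "dist z0 z < \<rho> / 4" using z by (simp add: B_def)
    have "z0 \<in> F" using z0 \<rho>(1) by (simp add: F_def)
    then have "F \<noteq> {}" by blast
    then obtain w where w: "w \<in> F" "\<And>y. y \<in> F \<Longrightarrow> dist z w \<le> dist z y"
      using distance_attains_inf[OF \<open>closed F\<close>, of z] by metis
    define s where "s = dist z w"
    have "s \<le> dist z z0" unfolding s_def by (rule w(2)) fact
    then have s_le: "s < \<rho> / 4" using zb by (simp add: dist_commute)
    have "z \<notin> F" using z by (simp add: F_def)
    then have "0 < s" using w by (auto simp: s_def)
    have "w \<in> cball z0 \<rho>"
      using dist_triangle[of z0 w z] zb s_le \<rho>(1) by (simp add: s_def)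
    have sub: "cball z s \<subseteq> cball z0 (2 * \<rho>)"
      using zb s_le \<rho>(1) by (auto simp: cball_subset_cball_iff dist_commute)
    have "cmod ((deriv ^^ 1) (\<lambda>y. G y - G w) z) \<le> fact 1 * (2 * K * s) / s ^ 1"
    proof (rule Cauchy_inequality)
      show "continuous_on (cball z s) (\<lambda>y. G y - G w)"
        by (intro continuous_intros continuous_on_subset[OF contQ sub])
      have "ball z s \<inter> F = {}" using w(2) by (force simp: s_def)
      then show "(\<lambda>y. G y - G w) holomorphic_on ball z s"
        using sub by (intro holomorphic_intros holF) auto
      show "0 < s" by fact
      fix y assume "norm (z - y) = s"
      then have "dist w y \<le> 2 * s"
        using dist_triangle[of w y z] by (simp add: s_def dist_norm norm_minus_commute)
      then have "norm (G y - G w) \<le> K * norm (y - w)"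
        using w(1) s_le \<rho>(1) \<open>w \<in> cball z0 \<rho>\<close> by (intro pt) (auto simp: F_def)
      also have "\<dots> \<le> K * (2 * s)"
        using \<open>dist w y \<le> 2 * s\<close> K(3) by (intro mult_left_mono) (auto simp: dist_norm norm_minus_commute)
      finally show "norm (G y - G w) \<le> 2 * K * s" by simp
    qed
    moreover have "deriv (\<lambda>y. G y - G w) z = deriv G z"
    proof -
      have "G analytic_on {z}" using z \<rho> by (auto simp: E_def B_def subset_iff)
      then have "G field_differentiable at z" by (rule analytic_on_imp_differentiable_at) simp
      then show ?thesis by simp
    qed
    ultimately show ?thesis using \<open>0 < s\<close> by simp
  qed
  have B_sub: "B \<subseteq> cball z0 \<rho>" "B \<subseteq> D" using \<rho> by (auto simp: B_def subset_iff)
  \<comment> \<open>A segment that misses \<open>E\<close> is handled by the derivative bound, one that meets \<open>E\<close> at \<open>w\<close> by a detour through \<open>w\<close>.\<close>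
  have lipB: "norm (G x - G y) \<le> 2 * K * norm (x - y)" if xy: "x \<in> B" "y \<in> B" for x y
  proof (cases "closed_segment x y \<inter> E = {}")
    case True
    have segB: "closed_segment x y \<subseteq> B"
      using xy by (simp add: B_def closed_segment_subset)
    show ?thesis
    proof (rule field_differentiable_bound[where S = "closed_segment x y" and f' = "deriv G"])
      fix z assume z: "z \<in> closed_segment x y"
      then have "z \<in> B" "z \<notin> E" using segB True by auto
      then show "norm (deriv G z) \<le> 2 * K" by (rule der)
      have "G analytic_on {z}" using \<open>z \<in> B\<close> \<open>z \<notin> E\<close> B_sub by (auto simp: E_def)
      then have "G field_differentiable at z" by (rule analytic_on_imp_differentiable_at) simp
      then show "(G has_field_derivative deriv G z) (at z within closed_segment x y)"
        by (simp add: DERIV_deriv_iff_field_differentiable has_field_derivative_at_within)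
    qed auto
  next
    case False
    then obtain w where w: "w \<in> closed_segment x y" "w \<in> E" by blast
    have "w \<in> B" using w(1) xy closed_segment_subset[of x B y] by (auto simp: B_def)
    have near: "v \<in> cball w \<rho>" if "v \<in> B" for v
      using that \<open>w \<in> B\<close> dist_triangle[of w v z0] \<rho>(1) by (simp add: B_def dist_commute)
    have "norm (G x - G y) \<le> norm (G x - G w) + norm (G y - G w)"
      using norm_triangle_ineq4[of "G x - G w" "G y - G w"] by simp
    also have "\<dots> \<le> K * norm (x - w) + K * norm (y - w)"
      using w(2) \<open>w \<in> B\<close> B_sub(1) near xy by (intro add_mono pt) auto
    also have "\<dots> = K * (dist x w + dist w y)"
      by (simp add: dist_norm norm_minus_commute algebra_simps)
    also have "dist x w + dist w y = dist x y"
      using w(1) between[of x y w] between_mem_segment[of x y w] by simp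
    also have "K * dist x y \<le> 2 * K * norm (x - y)"
      using K(3) by (simp add: dist_norm mult_right_mono)
    finally show ?thesis .
  qed
  have "G holomorphic_on B"
    unfolding holomorphic_on_def
  proof
    fix z assume z: "z \<in> B"
    then obtain \<tau> where "0 < \<tau>" "ball z \<tau> \<subseteq> B"
      unfolding B_def by (meson open_ball open_contains_ball)
    moreover obtain c where "\<forall>w. ((\<lambda>t::real. (G (z + of_real t * w) - G z) / of_real t) \<longlongrightarrow> w * c) (at_right 0)"
      using dir[of z] z B_sub by blast
    ultimately have "(G has_field_derivative c) (at z)"
      by (intro Lipschitz_Gateaux_imp_field_derivative[of \<tau> z G "2 * K"] lipB) blast+
    then show "G field_differentiable at z within B"
      by (meson field_differentiable_at_within field_differentiable_def)
  qed
  then have "G analytic_on {z0}"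
    using \<rho>(1) by (auto simp: B_def analytic_at intro!: exI[of _ "ball z0 (\<rho>/4)"])
  then show False using z0 by (simp add: E_def)
qed

section \<open>Functions differentiable along rays relative to a linear map onto the plane\<close>

lemma two_sided_real_derivative:
  fixes \<psi> :: "real \<Rightarrow> real"
  assumes "((\<lambda>s. (\<psi> (t + s) - \<psi> t) / s) \<longlongrightarrow> 0) (at_right 0)"
    and "((\<lambda>s. (\<psi> (t - s) - \<psi> t) / s) \<longlongrightarrow> 0) (at_right 0)"
  shows "(\<psi> has_real_derivative 0) (at t)"
proof -
  have "((\<lambda>s. - ((\<psi> (t - s) - \<psi> t) / s)) \<longlongrightarrow> - 0) (at_right 0)"
    using assms(2) by (rule tendsto_minus)
  then have "((\<lambda>s. (\<psi> (t + s) - \<psi> t) / s) \<longlongrightarrow> 0) (at_left 0)"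
    unfolding filterlim_at_left_to_right[of _ _ "0::real"] by simp
  with assms(1) have "((\<lambda>s. (\<psi> (t + s) - \<psi> t) / s) \<longlongrightarrow> 0) (at 0)"
    unfolding filterlim_at_split by simp
  then show ?thesis unfolding DERIV_def .
qed

lemma eventually_in_open_ray:
  fixes x h :: "'v::real_normed_vector"
  assumes "open B" "x \<in> B"
  shows "\<forall>\<^sub>F t in at_right 0. x + t *\<^sub>R h \<in> B"
proof -
  have "((\<lambda>t. x + t *\<^sub>R h) \<longlongrightarrow> x + 0 *\<^sub>R h) (at_right 0)"
    by (intro tendsto_intros)
  then show ?thesis using assms by (simp add: topological_tendstoD)
qed

text \<open>In directions from the kernel of \<open>L\<close> the derivative vanishes, so \<open>\<phi>\<close> is constant on the fibres of \<open>L\<close>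
  in \<open>B\<close>, which are connected because \<open>B\<close> is convex. Therefore \<open>\<phi>\<close> descends to a function on the open
  subset \<open>L ` B\<close> of the plane, and a linear right inverse \<open>R\<close> of \<open>L\<close> carries continuity and
  the directional limits over to it.\<close>

theorem directionally_differentiable_factors_holomorphically:
  fixes \<phi> :: "'v::euclidean_space \<Rightarrow> complex" and L :: "'v \<Rightarrow> complex"
  assumes "linear L" "surj L" "open B" "convex B" and cont: "continuous_on B \<phi>"
    and dir: "\<And>x. x \<in> B \<Longrightarrow> \<exists>c. \<forall>h. ((\<lambda>t. (\<phi> (x + t *\<^sub>R h) - \<phi> x) / of_real t) \<longlongrightarrow> L h * c) (at_right 0)"
  obtains G where "G holomorphic_on L ` B" "\<And>x. x \<in> B \<Longrightarrow> \<phi> x = G (L x)"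
proof -
  have along_kernel: "\<phi> x = \<phi> y" if xy: "x \<in> B" "y \<in> B" "L x = L y" for x y
  proof -
    define \<psi> where "\<psi> t = \<phi> (x + t *\<^sub>R (y - x))" for t
    have seg: "x + t *\<^sub>R (y - x) \<in> B" if "t \<in> {0..1}" for t
    proof -
      have "(1 - t) *\<^sub>R x + t *\<^sub>R y \<in> B" using that xy \<open>convex B\<close> by (intro convexD) auto
      then show ?thesis by (simp add: algebra_simps)
    qed
    have cont\<psi>: "continuous_on {0..1} \<psi>"
      unfolding \<psi>_def by (intro continuous_on_compose2[OF cont] continuous_intros) (use seg in auto)
    have L0: "L (y - x) = 0" "L (x - y) = 0" using xy(3) \<open>linear L\<close> by (simp_all add: linear_diff)
    have lim: "((\<lambda>s. (\<psi> (t + s) - \<psi> t) / of_real s) \<longlongrightarrow> 0) (at_right 0)"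
        "((\<lambda>s. (\<psi> (t - s) - \<psi> t) / of_real s) \<longlongrightarrow> 0) (at_right 0)" if t: "t \<in> {0..1}" for t
    proof -
      obtain c where c: "\<And>h. ((\<lambda>s. (\<phi> ((x + t *\<^sub>R (y - x)) + s *\<^sub>R h) - \<phi> (x + t *\<^sub>R (y - x))) / of_real s) \<longlongrightarrow> L h * c) (at_right 0)"
        using dir[OF seg[OF t]] by blast
      show "((\<lambda>s. (\<psi> (t + s) - \<psi> t) / of_real s) \<longlongrightarrow> 0) (at_right 0)"
        using c[of "y - x"] by (simp add: \<psi>_def L0 scaleR_left_distrib add.assoc)
      show "((\<lambda>s. (\<psi> (t - s) - \<psi> t) / of_real s) \<longlongrightarrow> 0) (at_right 0)"
        using c[of "x - y"] by (simp add: \<psi>_def L0 algebra_simps)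
    qed
    have Re: "Re (\<psi> 1) = Re (\<psi> 0)"
    proof (rule DERIV_isconst_end[where f = "\<lambda>t. Re (\<psi> t)"])
      show "continuous_on {0..1} (\<lambda>t. Re (\<psi> t))" by (intro continuous_intros cont\<psi>)
      fix t :: real assume "0 < t" "t < 1"
      then show "((\<lambda>t. Re (\<psi> t)) has_real_derivative 0) (at t)"
        using tendsto_Re[OF lim(1)[of t]] tendsto_Re[OF lim(2)[of t]] by (intro two_sided_real_derivative) auto
    qed simp
    have Im: "Im (\<psi> 1) = Im (\<psi> 0)"
    proof (rule DERIV_isconst_end[where f = "\<lambda>t. Im (\<psi> t)"])
      show "continuous_on {0..1} (\<lambda>t. Im (\<psi> t))" by (intro continuous_intros cont\<psi>)
      fix t :: real assume "0 < t" "t < 1"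
      then show "((\<lambda>t. Im (\<psi> t)) has_real_derivative 0) (at t)"
        using tendsto_Im[OF lim(1)[of t]] tendsto_Im[OF lim(2)[of t]] by (intro two_sided_real_derivative) auto
    qed simp
    show ?thesis using complex_eqI[OF Re Im] by (simp add: \<psi>_def)
  qed
  define G where "G z = \<phi> (SOME x. x \<in> B \<and> L x = z)" for z
  have GL: "\<phi> x = G (L x)" if "x \<in> B" for x
  proof -
    define y where "y = (SOME y. y \<in> B \<and> L y = L x)"
    have "y \<in> B \<and> L y = L x" unfolding y_def by (rule someI[of _ x]) (use that in simp)
    then show ?thesis unfolding G_def y_def[symmetric] using that by (intro along_kernel) auto
  qed
  obtain R where "linear R" "L \<circ> R = id"
    using linear_surjective_right_inverse[OF \<open>linear L\<close> \<open>surj L\<close>] by blast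
  then have LR: "L (R w) = w" for w by (metis comp_apply id_apply)
  have lift: "L (x + R w) = L x + w" for x w by (simp add: linear_add[OF \<open>linear L\<close>] LR)
  have "open (L ` B)"
    by (rule open_surjective_linear_image) fact+
  have "G holomorphic_on L ` B"
  proof (rule directionally_differentiable_imp_holomorphic)
    show "open (L ` B)" by fact
    show "continuous_on (L ` B) G"
    proof (intro continuous_at_imp_continuous_on ballI)
      fix z assume "z \<in> L ` B"
      then obtain x where x: "x \<in> B" "z = L x" by blast
      define g where "g w = x + R (w - z)" for w
      have contg: "continuous_on UNIV g"
        unfolding g_def by (intro continuous_intros linear_continuous_on_compose[OF _ \<open>linear R\<close>])
      have "open (g -` B)" using contg \<open>open B\<close> by (simp add: continuous_on_open_vimage)
      moreover have "z \<in> g -` B" using x by (simp add: g_def linear_0[OF \<open>linear R\<close>])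
      ultimately have ev: "\<forall>\<^sub>F w in nhds z. w \<in> g -` B" by (rule eventually_nhds_in_open)
      have "continuous_on (g -` B) (\<lambda>w. \<phi> (g w))"
        by (intro continuous_on_compose2[OF cont continuous_on_subset[OF contg]]) auto
      then have "isCont (\<lambda>w. \<phi> (g w)) z"
        using \<open>open (g -` B)\<close> \<open>z \<in> g -` B\<close> by (simp add: continuous_on_eq_continuous_at)
      moreover have "\<forall>\<^sub>F w in nhds z. G w = \<phi> (g w)"
        using ev by eventually_elim (use x in \<open>auto simp: GL g_def lift\<close>)
      ultimately show "isCont G z" by (simp add: isCont_cong)
    qed
    fix z assume "z \<in> L ` B"
    then obtain x where x: "x \<in> B" "z = L x" by blast
    obtain c where c: "\<And>h. ((\<lambda>t. (\<phi> (x + t *\<^sub>R h) - \<phi> x) / of_real t) \<longlongrightarrow> L h * c) (at_right 0)"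
      using dir[OF x(1)] by blast
    show "\<exists>c. \<forall>w. ((\<lambda>t::real. (G (z + of_real t * w) - G z) / of_real t) \<longlongrightarrow> w * c) (at_right 0)"
    proof (intro exI[of _ c] allI)
      fix w
      have "\<forall>\<^sub>F t in at_right 0. (\<phi> (x + t *\<^sub>R R w) - \<phi> x) / of_real t = (G (z + of_real t * w) - G z) / of_real t"
        using eventually_in_open_ray[OF \<open>open B\<close> x(1), of "R w"]
      proof eventually_elim
        case (elim t)
        have "L (x + t *\<^sub>R R w) = z + of_real t * w"
          by (simp add: x linear_add[OF \<open>linear L\<close>] linear_scale[OF \<open>linear L\<close>] LR scaleR_conv_of_real)
        then show ?case using GL[OF elim] GL[OF x(1)] x(2) by simp
      qed
      moreover have "((\<lambda>t. (\<phi> (x + t *\<^sub>R R w) - \<phi> x) / of_real t) \<longlongrightarrow> w * c) (at_right 0)"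
        using c[of "R w"] by (simp add: LR)
      ultimately show "((\<lambda>t::real. (G (z + of_real t * w) - G z) / of_real t) \<longlongrightarrow> w * c) (at_right 0)"
        by (rule Lim_transform_eventually[rotated])
    qed
  qed
  then show thesis using GL by (rule that)
qed

section \<open>Riemann--Stieltjes integrals over rectifiable curves\<close>

text \<open>The witness \<open>v t\<close> is the length of the arc over \<open>[0, t]\<close>. The estimates below use only that its
  increments dominate those of the curve, and that increments telescope over a division.\<close>

lemma rectifiable_variation_function:
  assumes "rectifiable g"
  obtains v :: "real \<Rightarrow> real"
    where "\<And>x y. 0 \<le> x \<Longrightarrow> x \<le> y \<Longrightarrow> y \<le> 1 \<Longrightarrow> dist (g x) (g y) \<le> v y - v x"
proof -
  define len where "len D = (\<Sum>K\<in>D. dist (g (Inf K)) (g (Sup K)))" for D :: "real set set"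
  from assms obtain L where L: "\<And>D. D division_of {0..1} \<Longrightarrow> len D \<le> L"
    unfolding rectifiable_def len_def by blast
  have append: "insert {x..y} D division_of {0..y}" if "D division_of {0..x}" "0 \<le> x" "x \<le> y" for D and x y :: real
  proof -
    have "{{x..y}} division_of {x..y}"
      using that division_of_self[of x y] by (simp add: box_real)
    then have "{{x..y}} \<union> D division_of {x..y} \<union> {0..x}"
      using that by (intro division_disjoint_union) (auto simp: interior_atLeastAtMost_real)
    also have "{x..y} \<union> {0..x} = {0..y}" using that by auto
    finally show ?thesis by simp
  qed
  have len_mono: "len D \<le> len (insert K D)" if "finite D" for D K
    unfolding len_def using that by (intro sum_mono2) auto
  define v where "v t = Sup (len ` {D. D division_of {0..t}})" for t
  have bdd: "bdd_above (len ` {D. D division_of {0..t}})" if "0 \<le> t" "t \<le> 1" for t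
  proof (rule bdd_aboveI2)
    fix D assume "D \<in> {D. D division_of {0..t}}"
    then have D: "D division_of {0..t}" by simp
    show "len D \<le> L"
      using len_mono[OF division_of_finite[OF D]] L[OF append[OF D that]] by (rule order_trans)
  qed
  have "dist (g x) (g y) \<le> v y - v x" if xy: "0 \<le> x" "x \<le> y" "y \<le> 1" for x y
  proof (cases "x = y")
    case False
    have "v x \<le> v y - dist (g x) (g y)"
      unfolding v_def[of x]
    proof (rule cSUP_least)
      have "{{0..x}} division_of {0..x}" using xy division_of_self[of 0 x] by (simp add: box_real)
      then show "{D. D division_of {0..x}} \<noteq> {}" by blast
      fix D assume "D \<in> {D. D division_of {0..x}}"
      then have D: "D division_of {0..x}" by simp
      have "{x..y} \<notin> D"
        using division_ofD(2)[OF D, of "{x..y}"] xy False by auto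
      then have "len (insert {x..y} D) = dist (g x) (g y) + len D"
        unfolding len_def using division_of_finite[OF D] xy by simp
      moreover have "len (insert {x..y} D) \<le> v y"
        unfolding v_def using append[OF D xy(1,2)] bdd[of y] xy by (intro cSUP_upper) auto
      ultimately show "len D \<le> v y - dist (g x) (g y)" by simp
    qed
    then show ?thesis by simp
  qed simp
  then show thesis by (rule that)
qed

definition stieltjes_sum :: "(real \<Rightarrow> real) \<Rightarrow> (real \<Rightarrow> real) \<Rightarrow> (real \<times> real set) set \<Rightarrow> real" where
  "stieltjes_sum u g p = (\<Sum>(t, K)\<in>p. u t * (g (Sup K) - g (Inf K)))"

definition mesh_below :: "real \<Rightarrow> (real \<times> real set) set \<Rightarrow> bool" where
  "mesh_below \<delta> p \<longleftrightarrow> (\<forall>(t, K)\<in>p. diameter K < \<delta>)"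

lemma mesh_below_mono: "mesh_below a p \<Longrightarrow> a \<le> b \<Longrightarrow> mesh_below b p"
  unfolding mesh_below_def by fastforce

lemma fine_tagged_division:
  assumes "0 < \<delta>"
  obtains p where "p tagged_division_of {0..1::real}" "mesh_below \<delta> p"
proof -
  have "gauge (\<lambda>x::real. ball x (\<delta> / 4))" using assms by (intro gauge_ball) auto
  then obtain p where p: "p tagged_division_of {0..1::real}" "(\<lambda>x. ball x (\<delta> / 4)) fine p"
    by (rule fine_division_exists_real)
  have "diameter K < \<delta>" if "(t, K) \<in> p" for t K
  proof -
    have "K \<subseteq> ball t (\<delta> / 4)" using p(2) that by (auto simp: fine_def)
    then have "diameter K \<le> diameter (ball t (\<delta> / 4))" by (intro diameter_subset) auto
    then show ?thesis using assms by (simp add: diameter_ball)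
  qed
  then have "mesh_below \<delta> p" by (auto simp: mesh_below_def)
  with p(1) show thesis by (rule that)
qed

lemma tagged_cell_real:
  fixes p :: "(real \<times> real set) set"
  assumes "p tagged_division_of {a..b}" "(t, K) \<in> p"
  shows "K = {Inf K..Sup K}" "Inf K \<le> t" "t \<le> Sup K" "a \<le> Inf K" "Sup K \<le> b" "Inf K \<le> Sup K"
proof -
  obtain c d where K: "K = {c..d}" using tagged_division_ofD(4)[OF assms] by auto
  have t: "t \<in> K" and sub: "K \<subseteq> {a..b}" using tagged_division_ofD(2,3)[OF assms] by auto
  have "c \<le> d" using t K by auto
  then have "Inf K = c" "Sup K = d" using K by auto
  then show "K = {Inf K..Sup K}" "Inf K \<le> t" "t \<le> Sup K" "a \<le> Inf K" "Sup K \<le> b" "Inf K \<le> Sup K"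
    using K t sub \<open>c \<le> d\<close> by auto
qed

text \<open>Both sums are expanded over pairs of cells. For cells \<open>K\<close>, \<open>L\<close> the number \<open>inc h K L\<close> is the increment
  of \<open>h\<close> over \<open>K \<inter> L\<close>, written with the map \<open>cl K\<close> that clamps the line to \<open>K\<close>. In this form it
  telescopes when \<open>L\<close> runs through a division, it vanishes for disjoint cells, and it is symmetric in
  \<open>K\<close> and \<open>L\<close>, so that no common refinement has to be formed. Tags of intersecting cells are
  closer than \<open>2 * \<delta>\<close>.\<close>

lemma stieltjes_sum_close:
  fixes u g v :: "real \<Rightarrow> real"
  assumes var: "\<And>x y. 0 \<le> x \<Longrightarrow> x \<le> y \<Longrightarrow> y \<le> 1 \<Longrightarrow> \<bar>g y - g x\<bar> \<le> v y - v x"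
    and p: "p tagged_division_of {0..1}" "mesh_below \<delta> p"
    and q: "q tagged_division_of {0..1}" "mesh_below \<delta> q"
    and osc: "\<And>s t. s \<in> {0..1} \<Longrightarrow> t \<in> {0..1} \<Longrightarrow> \<bar>s - t\<bar> < 2 * \<delta> \<Longrightarrow> \<bar>u s - u t\<bar> \<le> \<epsilon>"
    and "0 \<le> \<epsilon>"
  shows "\<bar>stieltjes_sum u g p - stieltjes_sum u g q\<bar> \<le> \<epsilon> * (v 1 - v 0)"
proof -
  define cl :: "real set \<Rightarrow> real \<Rightarrow> real" where "cl K x = max (Inf K) (min (Sup K) x)" for K x
  define inc where "inc h K L = h (cl K (Sup L)) - h (cl K (Inf L))" for h :: "real \<Rightarrow> real" and K L
  have inc_sum: "(\<Sum>(s, L)\<in>r. inc h K L) = h (Sup K) - h (Inf K)"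
    if r: "r tagged_division_of {0..1}" and K: "0 \<le> Inf K" "Inf K \<le> Sup K" "Sup K \<le> 1" for r h K
  proof -
    have "(\<Sum>(s, L)\<in>r. inc h K L) = h (cl K 1) - h (cl K 0)"
      unfolding inc_def using additive_tagged_division_1[OF _ r, of "\<lambda>x. h (cl K x)"] by simp
    then show ?thesis using K by (simp add: cl_def)
  qed
  have expand: "stieltjes_sum u g p' = (\<Sum>(t, K)\<in>p'. \<Sum>(s, L)\<in>q'. u t * inc g K L)"
    if p': "p' tagged_division_of {0..1}" and q': "q' tagged_division_of {0..1}" for p' q'
    unfolding stieltjes_sum_def
  proof (rule sum.cong[OF refl], clarify)
    fix t K assume tK: "(t, K) \<in> p'"
    have "(\<Sum>(s, L)\<in>q'. u t * inc g K L) = u t * (\<Sum>(s, L)\<in>q'. inc g K L)"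
      by (simp add: sum_distrib_left case_prod_unfold)
    also have "\<dots> = u t * (g (Sup K) - g (Inf K))"
      by (subst inc_sum[OF q' tagged_cell_real(4,6,5)[OF p' tK]]) auto
    finally show "u t * (g (Sup K) - g (Inf K)) = (\<Sum>(s, L)\<in>q'. u t * inc g K L)" by simp
  qed
  have sym: "inc g K L = inc g L K" if "Inf K \<le> Sup K" "Inf L \<le> Sup L" for K L
    using that by (auto simp: inc_def cl_def max_def min_def)
  have "stieltjes_sum u g q = (\<Sum>(t, K)\<in>p. \<Sum>(s, L)\<in>q. u s * inc g L K)"
    unfolding expand[OF q(1) p(1)] case_prod_unfold by (rule sum.swap)
  also have "\<dots> = (\<Sum>(t, K)\<in>p. \<Sum>(s, L)\<in>q. u s * inc g K L)"
  proof (intro sum.cong[OF refl], clarify, intro sum.cong[OF refl], clarify)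
    fix t K s L assume "(t, K) \<in> p" "(s, L) \<in> q"
    then have "inc g L K = inc g K L"
      by (intro sym tagged_cell_real(6)[OF p(1)] tagged_cell_real(6)[OF q(1)])
    then show "u s * inc g L K = u s * inc g K L" by simp
  qed
  finally have "stieltjes_sum u g p - stieltjes_sum u g q = (\<Sum>(t, K)\<in>p. \<Sum>(s, L)\<in>q. (u t - u s) * inc g K L)"
    unfolding expand[OF p(1) q(1)] by (simp add: sum_subtractf[symmetric] case_prod_unfold algebra_simps)
  also have "\<bar>\<dots>\<bar> \<le> (\<Sum>(t, K)\<in>p. \<Sum>(s, L)\<in>q. \<epsilon> * inc v K L)"
    unfolding case_prod_unfold
  proof (rule order_trans[OF sum_abs sum_mono], rule order_trans[OF sum_abs sum_mono])
    fix a b assume ab: "a \<in> p" "b \<in> q"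
    obtain t K s L where eq: "a = (t, K)" "b = (s, L)" by fastforce
    note tK = tagged_cell_real[OF p(1), of t K] and sL = tagged_cell_real[OF q(1), of s L]
    have K: "K = {Inf K..Sup K}" "Inf K \<le> t" "t \<le> Sup K" "0 \<le> Inf K" "Sup K \<le> 1"
      and L: "L = {Inf L..Sup L}" "Inf L \<le> s" "s \<le> Sup L" "0 \<le> Inf L" "Sup L \<le> 1"
      using tK(1-5) sL(1-5) ab unfolding eq by simp_all
    have le: "\<bar>inc g K L\<bar> \<le> inc v K L"
      unfolding inc_def using K L by (intro var) (auto simp: cl_def)
    have "\<bar>u t - u s\<bar> * \<bar>inc g K L\<bar> \<le> \<epsilon> * \<bar>inc g K L\<bar>"
    proof (cases "inc g K L = 0")
      case False
      then have "Inf L \<le> Sup K" "Inf K \<le> Sup L"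
        using K(2,3) L(2,3) by (auto simp: inc_def cl_def max_def min_def split: if_splits)
      then have "max (Inf K) (Inf L) \<in> {Inf K..Sup K}" "max (Inf K) (Inf L) \<in> {Inf L..Sup L}"
        using K(2,3) L(2,3) by auto
      then have x: "max (Inf K) (Inf L) \<in> K" "max (Inf K) (Inf L) \<in> L"
        by (simp_all only: K(1)[symmetric] L(1)[symmetric])
      have "bounded {Inf K..Sup K}" "bounded {Inf L..Sup L}" "t \<in> {Inf K..Sup K}" "s \<in> {Inf L..Sup L}"
        using K(2,3) L(2,3) by auto
      then have bd: "bounded K" "bounded L" "t \<in> K" "s \<in> L"
        by (simp_all only: K(1)[symmetric] L(1)[symmetric])
      have "\<bar>t - s\<bar> \<le> dist t (max (Inf K) (Inf L)) + dist (max (Inf K) (Inf L)) s"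
        unfolding dist_real_def by linarith
      also have "\<dots> \<le> diameter K + diameter L"
        using bd x by (intro add_mono diameter_bounded_bound)
      also have "\<dots> < 2 * \<delta>" using p(2) q(2) ab eq unfolding mesh_below_def by fastforce
      finally show ?thesis
        using K L by (intro mult_right_mono osc) auto
    qed auto
    also have "\<dots> \<le> \<epsilon> * inc v K L" using le \<open>0 \<le> \<epsilon>\<close> by (rule mult_left_mono)
    finally show "\<bar>(u (fst a) - u (fst b)) * inc g (snd a) (snd b)\<bar> \<le> \<epsilon> * inc v (snd a) (snd b)"
      by (simp add: eq abs_mult)
  qed
  also have "\<dots> = \<epsilon> * (\<Sum>(t, K)\<in>p. \<Sum>(s, L)\<in>q. inc v K L)"
    by (simp add: sum_distrib_left case_prod_unfold)
  also have "(\<Sum>(t, K)\<in>p. \<Sum>(s, L)\<in>q. inc v K L) = (\<Sum>(t, K)\<in>p. v (Sup K) - v (Inf K))"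
  proof (intro sum.cong[OF refl], clarify)
    fix t K assume tK: "(t, K) \<in> p"
    show "(\<Sum>(s, L)\<in>q. inc v K L) = v (Sup K) - v (Inf K)"
      by (rule inc_sum[OF q(1) tagged_cell_real(4,6,5)[OF p(1) tK]])
  qed
  also have "\<dots> = v 1 - v 0" using additive_tagged_division_1[OF _ p(1), of v] by simp
  finally show ?thesis .
qed

lemma has_stieltjes_integral_alt:
  "has_stieltjes_integral u g J \<longleftrightarrow>
     (\<forall>\<epsilon>>0. \<exists>\<delta>>0. \<forall>p. p tagged_division_of {0..1} \<and> mesh_below \<delta> p \<longrightarrow> \<bar>stieltjes_sum u g p - J\<bar> < \<epsilon>)"
  by (simp add: has_stieltjes_integral_def stieltjes_sum_def mesh_below_def)

lemma has_stieltjes_integralE: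
  assumes "has_stieltjes_integral u g J" "0 < \<epsilon>"
  obtains \<delta> where "0 < \<delta>"
    "\<forall>p. p tagged_division_of {0..1} \<longrightarrow> mesh_below \<delta> p \<longrightarrow> \<bar>stieltjes_sum u g p - J\<bar> < \<epsilon>"
  using assms(1)[unfolded has_stieltjes_integral_alt, rule_format, OF assms(2)]
  by (simp only: imp_conjL) (elim exE conjE, rule that)

text \<open>By \<open>stieltjes_sum_close\<close> and uniform continuity the sums satisfy the Cauchy criterion as the
  mesh tends to \<open>0\<close>.\<close>

lemma has_stieltjes_integral_exists:
  fixes u g v :: "real \<Rightarrow> real"
  assumes var: "\<And>x y. 0 \<le> x \<Longrightarrow> x \<le> y \<Longrightarrow> y \<le> 1 \<Longrightarrow> \<bar>g y - g x\<bar> \<le> v y - v x"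
    and cont: "continuous_on {0..1} u"
  obtains J where "has_stieltjes_integral u g J"
proof -
  have V0: "0 \<le> v 1 - v 0" using var[of 0 1] by simp
  have close: "\<exists>\<delta>>0. \<forall>p q. p tagged_division_of {0..1} \<and> mesh_below \<delta> p \<and> q tagged_division_of {0..1} \<and> mesh_below \<delta> q
      \<longrightarrow> \<bar>stieltjes_sum u g p - stieltjes_sum u g q\<bar> < \<epsilon>" if "0 < \<epsilon>" for \<epsilon>
  proof -
    define \<eta> where "\<eta> = \<epsilon> / (v 1 - v 0 + 1)"
    have "0 < \<eta>" using that V0 by (simp add: \<eta>_def)
    have "uniformly_continuous_on {0..1} u"
      using cont by (intro compact_uniformly_continuous) auto
    then obtain d where d: "0 < d" "\<And>s t. s \<in> {0..1} \<Longrightarrow> t \<in> {0..1} \<Longrightarrow> dist t s < d \<Longrightarrow> dist (u t) (u s) < \<eta>"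
      using \<open>0 < \<eta>\<close> unfolding uniformly_continuous_on_def by metis
    have "\<bar>stieltjes_sum u g p - stieltjes_sum u g q\<bar> < \<epsilon>"
      if "p tagged_division_of {0..1}" "mesh_below (d / 2) p" "q tagged_division_of {0..1}" "mesh_below (d / 2) q" for p q
    proof -
      have "\<bar>stieltjes_sum u g p - stieltjes_sum u g q\<bar> \<le> \<eta> * (v 1 - v 0)"
      proof (rule stieltjes_sum_close[OF var that])
        fix s t :: real assume "s \<in> {0..1}" "t \<in> {0..1}" "\<bar>s - t\<bar> < 2 * (d / 2)"
        then show "\<bar>u s - u t\<bar> \<le> \<eta>" using d(2)[of t s] by (simp add: dist_real_def)
      qed (use \<open>0 < \<eta>\<close> in auto)
      also have "\<dots> < \<eta> * (v 1 - v 0 + 1)" using \<open>0 < \<eta>\<close> by simp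
      also have "\<dots> = \<epsilon>" using V0 by (simp add: \<eta>_def)
      finally show ?thesis .
    qed
    then show ?thesis using d(1) by (intro exI[of _ "d / 2"]) auto
  qed
  have "\<forall>n. \<exists>p. p tagged_division_of {0..1::real} \<and> mesh_below (inverse (real (Suc n))) p"
    using fine_tagged_division by (metis inverse_positive_iff_positive of_nat_0_less_iff zero_less_Suc)
  then obtain P where P: "\<And>n. P n tagged_division_of {0..1::real}" "\<And>n. mesh_below (inverse (real (Suc n))) (P n)"
    by metis
  have ev: "\<exists>N. \<forall>n\<ge>N. mesh_below \<delta> (P n)" if pos: "0 < \<delta>" for \<delta>
  proof -
    obtain N where N: "inverse (real (Suc N)) < \<delta>" using reals_Archimedean[OF pos] by blast
    have "mesh_below \<delta> (P n)" if "n \<ge> N" for n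
    proof (rule mesh_below_mono[OF P(2)])
      have "inverse (real (Suc n)) \<le> inverse (real (Suc N))" using that by (simp add: field_simps)
      then show "inverse (real (Suc n)) \<le> \<delta>" using N by linarith
    qed
    then show ?thesis by blast
  qed
  have "Cauchy (\<lambda>n. stieltjes_sum u g (P n))"
    unfolding Cauchy_def dist_real_def
  proof (intro allI impI)
    fix \<epsilon> :: real assume "0 < \<epsilon>"
    from close[OF this] obtain \<delta> where \<delta>: "0 < \<delta>" "\<And>p q. p tagged_division_of {0..1} \<Longrightarrow> mesh_below \<delta> p \<Longrightarrow>
        q tagged_division_of {0..1} \<Longrightarrow> mesh_below \<delta> q \<Longrightarrow> \<bar>stieltjes_sum u g p - stieltjes_sum u g q\<bar> < \<epsilon>" by blast
    from ev[OF \<delta>(1)] obtain N where "\<And>n. n \<ge> N \<Longrightarrow> mesh_below \<delta> (P n)" by blast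
    then show "\<exists>M. \<forall>m\<ge>M. \<forall>n\<ge>M. \<bar>stieltjes_sum u g (P m) - stieltjes_sum u g (P n)\<bar> < \<epsilon>"
      using \<delta>(2) P(1) by blast
  qed
  then obtain J where J: "(\<lambda>n. stieltjes_sum u g (P n)) \<longlonglongrightarrow> J"
    using Cauchy_convergent convergent_def by blast
  have "has_stieltjes_integral u g J"
    unfolding has_stieltjes_integral_alt
  proof (intro allI impI)
    fix \<epsilon> :: real assume "0 < \<epsilon>"
    then have "0 < \<epsilon> / 2" by simp
    from close[OF this] obtain \<delta> where \<delta>: "0 < \<delta>" "\<And>p q. p tagged_division_of {0..1} \<Longrightarrow> mesh_below \<delta> p \<Longrightarrow>
        q tagged_division_of {0..1} \<Longrightarrow> mesh_below \<delta> q \<Longrightarrow> \<bar>stieltjes_sum u g p - stieltjes_sum u g q\<bar> < \<epsilon> / 2" by blast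
    from ev[OF \<delta>(1)] obtain N where N: "\<And>n. n \<ge> N \<Longrightarrow> mesh_below \<delta> (P n)" by blast
    from LIMSEQ_D[OF J \<open>0 < \<epsilon> / 2\<close>] obtain M where M: "\<And>n. n \<ge> M \<Longrightarrow> \<bar>stieltjes_sum u g (P n) - J\<bar> < \<epsilon> / 2" by auto
    have "\<bar>stieltjes_sum u g p - J\<bar> < \<epsilon>" if "p tagged_division_of {0..1} \<and> mesh_below \<delta> p" for p
    proof -
      have "\<bar>stieltjes_sum u g p - stieltjes_sum u g (P (max M N))\<bar> < \<epsilon> / 2"
        using that by (intro \<delta>(2) P(1) N) auto
      moreover have "\<bar>stieltjes_sum u g (P (max M N)) - J\<bar> < \<epsilon> / 2"
        by (intro M) auto
      ultimately show ?thesis by linarith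
    qed
    then show "\<exists>\<delta>>0. \<forall>p. p tagged_division_of {0..1} \<and> mesh_below \<delta> p \<longrightarrow> \<bar>stieltjes_sum u g p - J\<bar> < \<epsilon>"
      using \<delta>(1) by blast
  qed
  then show thesis by (rule that)
qed

lemma has_stieltjes_integral_unique:
  assumes "has_stieltjes_integral u g J" "has_stieltjes_integral u g J'"
  shows "J = J'"
proof (rule ccontr)
  assume "J \<noteq> J'"
  then have pos: "0 < \<bar>J - J'\<bar> / 2" by simp
  from has_stieltjes_integralE[OF assms(1) pos]
  obtain \<delta> where \<delta>: "0 < \<delta>" "\<forall>p. p tagged_division_of {0..1} \<longrightarrow> mesh_below \<delta> p \<longrightarrow> \<bar>stieltjes_sum u g p - J\<bar> < \<bar>J - J'\<bar> / 2" .
  from has_stieltjes_integralE[OF assms(2) pos]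
  obtain \<delta>' where \<delta>': "0 < \<delta>'" "\<forall>p. p tagged_division_of {0..1} \<longrightarrow> mesh_below \<delta>' p \<longrightarrow> \<bar>stieltjes_sum u g p - J'\<bar> < \<bar>J - J'\<bar> / 2" .
  obtain p where p: "p tagged_division_of {0..1::real}" "mesh_below (min \<delta> \<delta>') p"
    using fine_tagged_division[of "min \<delta> \<delta>'"] \<delta> \<delta>' by auto
  have "mesh_below \<delta> p" "mesh_below \<delta>' p" using p(2) by (auto elim: mesh_below_mono)
  then show False using \<delta>(2)[THEN spec, THEN mp, THEN mp, OF p(1)] \<delta>'(2)[THEN spec, THEN mp, THEN mp, OF p(1)] by argo
qed

lemma has_stieltjes_integral_cmult:
  assumes "has_stieltjes_integral u g J"
  shows "has_stieltjes_integral (\<lambda>t. c * u t) g (c * J)"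
  unfolding has_stieltjes_integral_alt
proof (intro allI impI)
  fix \<epsilon> :: real assume "0 < \<epsilon>"
  then have "0 < \<epsilon> / (\<bar>c\<bar> + 1)" by simp
  from has_stieltjes_integralE[OF assms this]
  obtain \<delta> where \<delta>: "0 < \<delta>" "\<forall>p. p tagged_division_of {0..1} \<longrightarrow> mesh_below \<delta> p \<longrightarrow> \<bar>stieltjes_sum u g p - J\<bar> < \<epsilon> / (\<bar>c\<bar> + 1)" .
  have "\<bar>stieltjes_sum (\<lambda>t. c * u t) g p - c * J\<bar> < \<epsilon>" if "p tagged_division_of {0..1}" "mesh_below \<delta> p" for p
  proof -
    have "stieltjes_sum (\<lambda>t. c * u t) g p = c * stieltjes_sum u g p"
      by (simp add: stieltjes_sum_def sum_distrib_left case_prod_unfold mult.assoc)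
    then have "\<bar>stieltjes_sum (\<lambda>t. c * u t) g p - c * J\<bar> = \<bar>c\<bar> * \<bar>stieltjes_sum u g p - J\<bar>"
      by (simp add: abs_mult[symmetric] right_diff_distrib)
    also have "\<dots> \<le> (\<bar>c\<bar> + 1) * \<bar>stieltjes_sum u g p - J\<bar>" by (intro mult_right_mono) auto
    also have "\<dots> < \<epsilon>" using \<delta>(2)[THEN spec, THEN mp, THEN mp, OF that] by (simp add: field_simps)
    finally show ?thesis .
  qed
  then show "\<exists>\<delta>>0. \<forall>p. p tagged_division_of {0..1} \<and> mesh_below \<delta> p \<longrightarrow> \<bar>stieltjes_sum (\<lambda>t. c * u t) g p - c * J\<bar> < \<epsilon>"
    using \<delta>(1) by blast
qed

lemma has_stieltjes_integral_add:
  assumes "has_stieltjes_integral u g J" "has_stieltjes_integral u' g J'"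
  shows "has_stieltjes_integral (\<lambda>t. u t + u' t) g (J + J')"
  unfolding has_stieltjes_integral_alt
proof (intro allI impI)
  fix \<epsilon> :: real assume "0 < \<epsilon>"
  then have pos: "0 < \<epsilon> / 2" by simp
  from has_stieltjes_integralE[OF assms(1) pos]
  obtain \<delta> where \<delta>: "0 < \<delta>" "\<forall>p. p tagged_division_of {0..1} \<longrightarrow> mesh_below \<delta> p \<longrightarrow> \<bar>stieltjes_sum u g p - J\<bar> < \<epsilon> / 2" .
  from has_stieltjes_integralE[OF assms(2) pos]
  obtain \<delta>' where \<delta>': "0 < \<delta>'" "\<forall>p. p tagged_division_of {0..1} \<longrightarrow> mesh_below \<delta>' p \<longrightarrow> \<bar>stieltjes_sum u' g p - J'\<bar> < \<epsilon> / 2" .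
  have "\<bar>stieltjes_sum (\<lambda>t. u t + u' t) g p - (J + J')\<bar> < \<epsilon>"
    if "p tagged_division_of {0..1}" "mesh_below (min \<delta> \<delta>') p" for p
  proof -
    have "mesh_below \<delta> p" "mesh_below \<delta>' p" using that(2) by (auto elim: mesh_below_mono)
    moreover have "stieltjes_sum (\<lambda>t. u t + u' t) g p = stieltjes_sum u g p + stieltjes_sum u' g p"
      by (simp add: stieltjes_sum_def sum.distrib case_prod_unfold distrib_right)
    ultimately show ?thesis using \<delta>(2)[THEN spec, THEN mp, THEN mp, OF that(1)] \<delta>'(2)[THEN spec, THEN mp, THEN mp, OF that(1)] by linarith
  qed
  then show "\<exists>\<delta>>0. \<forall>p. p tagged_division_of {0..1} \<and> mesh_below \<delta> p \<longrightarrow> \<bar>stieltjes_sum (\<lambda>t. u t + u' t) g p - (J + J')\<bar> < \<epsilon>"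
    using \<delta>(1) \<delta>'(1) by (intro exI[of _ "min \<delta> \<delta>'"]) auto
qed

lemma has_stieltjes_integral_sum:
  assumes "finite A" "\<And>r. r \<in> A \<Longrightarrow> has_stieltjes_integral (u r) g (J r)"
  shows "has_stieltjes_integral (\<lambda>t. \<Sum>r\<in>A. u r t) g (\<Sum>r\<in>A. J r)"
  using assms
proof (induction A rule: finite_induct)
  case empty
  then show ?case by (auto simp: has_stieltjes_integral_def intro!: exI[of _ 1])
next
  case (insert r A)
  then show ?case by (simp add: has_stieltjes_integral_add)
qed

text \<open>A line integral is defined by a definite description, so it means something only once existence and
  uniqueness are known.\<close>

lemma has_stieltjes_integral_line_integral:
  fixes \<gamma> :: "real \<Rightarrow> real ^ 'k"
  assumes "rectifiable \<gamma>" "continuous_on (path_image \<gamma>) U"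
  shows "has_stieltjes_integral (\<lambda>t. U (\<gamma> t)) (\<lambda>t. \<gamma> t $ j) (line_integral U \<gamma> j)"
proof -
  obtain v where v: "\<And>x y. 0 \<le> x \<Longrightarrow> x \<le> y \<Longrightarrow> y \<le> 1 \<Longrightarrow> dist (\<gamma> x) (\<gamma> y) \<le> v y - v x"
    using rectifiable_variation_function[OF assms(1)] by blast
  have "\<bar>\<gamma> y $ j - \<gamma> x $ j\<bar> \<le> v y - v x" if "0 \<le> x" "x \<le> y" "y \<le> 1" for x y
  proof -
    have "\<bar>\<gamma> y $ j - \<gamma> x $ j\<bar> = \<bar>(\<gamma> x - \<gamma> y) $ j\<bar>" by simp
    also have "\<dots> \<le> dist (\<gamma> x) (\<gamma> y)" unfolding dist_norm by (rule component_le_norm_cart)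
    finally show ?thesis using v[OF that] by linarith
  qed
  moreover have "continuous_on {0..1} (\<lambda>t. U (\<gamma> t))"
    using assms unfolding rectifiable_def path_def path_image_def
    by (auto intro: continuous_on_compose2)
  ultimately obtain J where "has_stieltjes_integral (\<lambda>t. U (\<gamma> t)) (\<lambda>t. \<gamma> t $ j) J"
    by (rule has_stieltjes_integral_exists)
  then show ?thesis
    unfolding line_integral_def by (metis has_stieltjes_integral_unique theI)
qed

section \<open>Locally exact forms on null-homotopic loops\<close>

text \<open>The function \<open>W\<close> exists because a convex set has no holes. \<open>W x\<close> adds up \<open>c\<close> along a subdivided
  segment from a base point \<open>b\<close> to \<open>x\<close>. For nearby \<open>x\<close> and \<open>y\<close> corresponding division points are near each
  other, the cocycle identity for the thin quadrilaterals between the two segments turns the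
  difference of the sums into a telescoping sum, and only \<open>c x y\<close> remains.\<close>

lemma cocycle_on_convex_is_coboundary:
  fixes S :: "'b::real_normed_vector set" and c :: "'b \<Rightarrow> 'b \<Rightarrow> real"
  assumes "convex S" "bounded S" "0 < d"
    and cocycle: "\<And>x y z. x \<in> S \<Longrightarrow> y \<in> S \<Longrightarrow> z \<in> S \<Longrightarrow> dist x y < d \<Longrightarrow> dist y z < d \<Longrightarrow> dist x z < d
      \<Longrightarrow> c x y + c y z = c x z"
  shows "\<exists>W. \<forall>x\<in>S. \<forall>y\<in>S. dist x y < d / 2 \<longrightarrow> W y - W x = c x y"
proof (cases "S = {}")
  case False
  then obtain b where "b \<in> S" by blast
  obtain M where M: "0 < M" "\<And>x. x \<in> S \<Longrightarrow> norm x \<le> M"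
    using \<open>bounded S\<close> bounded_pos by blast
  obtain n where n: "inverse (real (Suc n)) < d / (4 * M)"
    using reals_Archimedean[of "d / (4 * M)"] M(1) \<open>0 < d\<close> by auto
  define N where "N = Suc n"
  define pt where "pt x i = b + (real i / real N) *\<^sub>R (x - b)" for x and i :: nat
  have pt_in: "pt x i \<in> S" if "x \<in> S" "i \<le> N" for x i
  proof -
    have "pt x i = (1 - real i / real N) *\<^sub>R b + (real i / real N) *\<^sub>R x"
      by (simp add: pt_def algebra_simps)
    then show ?thesis
      using that \<open>b \<in> S\<close> \<open>convex S\<close> by (auto intro!: convexD simp: N_def)
  qed
  have step: "dist (pt x i) (pt x (Suc i)) < d / 2" if "x \<in> S" for x i
  proof -
    have "pt x (Suc i) - pt x i = (1 / real N) *\<^sub>R (x - b)"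
      by (simp add: pt_def scaleR_left_diff_distrib[symmetric] diff_divide_distrib[symmetric])
    then have "dist (pt x i) (pt x (Suc i)) = norm (x - b) * (1 / real N)"
      by (simp add: dist_norm norm_minus_commute[of "pt x i"])
    also have "\<dots> \<le> (2 * M) * (1 / real N)"
      using norm_triangle_ineq4[of x b] M(2)[OF that] M(2)[OF \<open>b \<in> S\<close>] by (intro mult_right_mono) auto
    also have "\<dots> < d / 2"
      using n M(1) by (simp add: N_def field_simps)
    finally show ?thesis .
  qed
  have par: "dist (pt x i) (pt y i) \<le> dist x y" if "i \<le> N" for x y i
  proof -
    have "pt x i - pt y i = (real i / real N) *\<^sub>R (x - y)"
      by (simp add: pt_def algebra_simps)
    then have "dist (pt x i) (pt y i) = (real i / real N) * dist x y"
      by (simp add: dist_norm)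
    also have "\<dots> \<le> 1 * dist x y"
      using that by (intro mult_right_mono) (auto simp: N_def)
    finally show ?thesis by simp
  qed
  define W where "W x = (\<Sum>i<N. c (pt x i) (pt x (Suc i)))" for x
  have diag: "c x x = 0" if "x \<in> S" for x
    using cocycle[of x x x] that \<open>0 < d\<close> by simp
  have "W y - W x = c x y" if xy: "x \<in> S" "y \<in> S" "dist x y < d / 2" for x y
  proof -
    have "c (pt y i) (pt y (Suc i)) - c (pt x i) (pt x (Suc i))
        = c (pt x (Suc i)) (pt y (Suc i)) - c (pt x i) (pt y i)" if "i < N" for i
    proof -
      have near: "dist (pt x i) (pt y i) < d / 2" "dist (pt x (Suc i)) (pt y (Suc i)) < d / 2"
        using par[of i x y] par[of "Suc i" x y] xy(3) that by auto
      have far: "dist (pt x i) (pt y (Suc i)) < d"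
        using dist_triangle[of "pt x i" "pt y (Suc i)" "pt y i"] near(1) step[OF xy(2), of i] by linarith
      have "c (pt x i) (pt x (Suc i)) + c (pt x (Suc i)) (pt y (Suc i)) = c (pt x i) (pt y (Suc i))"
        using step[OF xy(1), of i] near far that xy \<open>0 < d\<close> by (intro cocycle pt_in) auto
      moreover have "c (pt x i) (pt y i) + c (pt y i) (pt y (Suc i)) = c (pt x i) (pt y (Suc i))"
        using step[OF xy(2), of i] near far that xy \<open>0 < d\<close> by (intro cocycle pt_in) auto
      ultimately show ?thesis by simp
    qed
    then have "W y - W x = (\<Sum>i<N. c (pt x (Suc i)) (pt y (Suc i)) - c (pt x i) (pt y i))"
      by (simp add: W_def sum_subtractf[symmetric])
    also have "\<dots> = c (pt x N) (pt y N) - c (pt x 0) (pt y 0)"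
      by (rule sum_lessThan_telescope)
    also have "\<dots> = c x y"
      using diag[OF \<open>b \<in> S\<close>] by (simp add: pt_def N_def)
    finally show ?thesis .
  qed
  then show ?thesis by blast
qed auto

lemma primitive_increment_unique:
  fixes V V' :: "'a::euclidean_space \<Rightarrow> real"
  assumes "convex C" "open C"
    and "\<And>x. x \<in> C \<Longrightarrow> (V has_derivative \<omega> x) (at x)"
    and "\<And>x. x \<in> C \<Longrightarrow> (V' has_derivative \<omega> x) (at x)"
    and "x \<in> C" "y \<in> C"
  shows "V y - V x = V' y - V' x"
proof -
  have "\<exists>k. \<forall>x\<in>C. V x - V' x = k"
  proof (rule has_derivative_zero_constant[OF \<open>convex C\<close>])
    fix x assume "x \<in> C"
    then have "((\<lambda>x. V x - V' x) has_derivative (\<lambda>h. \<omega> x h - \<omega> x h)) (at x)"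
      by (intro has_derivative_diff assms)
    then show "((\<lambda>x. V x - V' x) has_derivative (\<lambda>h. 0)) (at x within C)"
      by (auto intro: has_derivative_at_withinI)
  qed
  then obtain k where "V x - V' x = k" "V y - V' y = k" using assms(5,6) by blast
  then show ?thesis by simp
qed

text \<open>Let \<open>h\<close> be a homotopy on the square \<open>Q\<close> from \<open>\<gamma>\<close> to a constant loop. The increments \<open>c\<close> of local
  primitives between nearby values of \<open>h\<close> form a cocycle on \<open>Q\<close>, hence they are the increments of a
  function \<open>W\<close>. The homotopy is constant on one side of \<open>Q\<close> and takes the same values on
  the two adjacent sides, so \<open>W\<close> agrees at the ends of the side that carries \<open>\<gamma>\<close>. On the other hand,
  by the mean value inequality, each cell of a fine Riemann--Stieltjes sum along \<open>\<gamma>\<close>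
  equals the increment of \<open>W\<close> up to a small multiple of the arc length, so the line integral is the total
  increment of \<open>W\<close> along that side.\<close>

theorem locally_exact_line_integral_eq_0:
  fixes \<gamma> :: "real \<Rightarrow> real ^ 'k" and P :: "'k::finite \<Rightarrow> real ^ 'k \<Rightarrow> real"
  assumes "open G" and rect: "rectifiable \<gamma>" and hom: "homotopic_loops G \<gamma> (\<lambda>t. a)"
    and cont: "\<And>j. continuous_on G (P j)"
    and exact: "\<And>p r. 0 < r \<Longrightarrow> ball p r \<subseteq> G \<Longrightarrow>
      \<exists>V. \<forall>x\<in>ball p r. (V has_derivative (\<lambda>h. \<Sum>j\<in>UNIV. P j x * h $ j)) (at x)"
  shows "(\<Sum>j\<in>UNIV. line_integral (P j) \<gamma> j) = 0"
proof -
  define Q where "Q = {0..1::real} \<times> {0..1::real}"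
  obtain h where conth: "continuous_on Q h" and hG: "h \<in> Q \<rightarrow> G"
    and h0: "\<And>x. x \<in> {0..1} \<Longrightarrow> h (0, x) = \<gamma> x" and h1: "\<And>x. x \<in> {0..1} \<Longrightarrow> h (1, x) = a"
    and hloop: "\<And>t. t \<in> {0..1} \<Longrightarrow> h (t, 1) = h (t, 0)"
    using hom unfolding homotopic_loops pathstart_def pathfinish_def Q_def by auto
  have "compact Q" "convex Q" "bounded Q"
    unfolding Q_def by (auto intro!: compact_Times convex_Times bounded_Times)
  have cKc: "compact (h ` Q)"
    using conth \<open>compact Q\<close> by (rule compact_continuous_image)
  have "h ` Q \<subseteq> G" using hG by auto
  obtain r where r: "0 < r" "(\<Union>x\<in>h ` Q. ball x r) \<subseteq> G"
    using compact_subset_open_imp_ball_epsilon_subset[OF cKc \<open>open G\<close> \<open>h ` Q \<subseteq> G\<close>] by blast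
  define \<omega> where "\<omega> x h = (\<Sum>j\<in>UNIV. P j x * h $ j)" for x h :: "real ^ 'k"
  have "\<forall>p\<in>h ` Q. \<exists>V. \<forall>x\<in>ball p r. (V has_derivative \<omega> x) (at x)"
    using exact r unfolding \<omega>_def by blast
  then obtain V where V: "\<And>p x. p \<in> h ` Q \<Longrightarrow> x \<in> ball p r \<Longrightarrow> (V p has_derivative \<omega> x) (at x)"
    by metis
  define c where "c x y = V (h x) (h y) - V (h x) (h x)" for x y
  have "uniformly_continuous_on Q h"
    using conth \<open>compact Q\<close> by (rule compact_uniformly_continuous)
  then obtain d where d: "0 < d" "\<And>x y. x \<in> Q \<Longrightarrow> y \<in> Q \<Longrightarrow> dist x y < d \<Longrightarrow> dist (h x) (h y) < r / 2"
    using r(1) unfolding uniformly_continuous_on_def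
    by (metis dist_commute half_gt_zero)
  have coc: "c x y + c y z = c x z"
    if "x \<in> Q" "y \<in> Q" "z \<in> Q" "dist x y < d" "dist y z < d" "dist x z < d" for x y z
  proof -
    have "dist (h x) (h y) < r" "dist (h y) (h z) < r" "dist (h x) (h z) < r"
      using d(2)[of x y] d(2)[of y z] d(2)[of x z] that r(1) by auto
    then have "V (h x) (h z) - V (h x) (h y) = V (h y) (h z) - V (h y) (h y)"
      using that r(1) by (intro primitive_increment_unique[of "ball (h x) r \<inter> ball (h y) r" _ \<omega>])
        (auto intro!: V convex_Int simp: dist_commute)
    then show ?thesis by (simp add: c_def)
  qed
  have "\<exists>W. \<forall>x\<in>Q. \<forall>y\<in>Q. dist x y < d / 2 \<longrightarrow> W y - W x = c x y"
    using \<open>convex Q\<close> \<open>bounded Q\<close> d(1) coc by (rule cocycle_on_convex_is_coboundary)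
  then obtain W where W: "\<And>x y. x \<in> Q \<Longrightarrow> y \<in> Q \<Longrightarrow> dist x y < d / 2 \<Longrightarrow> W y - W x = c x y" by blast

  \<comment> \<open>The increments of \<open>W\<close> along three sides of \<open>Q\<close> are sums of \<open>c\<close>, which depends only on the values of \<open>h\<close>.\<close>
  have loop: "W (0, 1) = W (0, 0)"
  proof -
    obtain n where n: "inverse (real (Suc n)) < d / 2"
      using reals_Archimedean[of "d / 2"] d(1) by auto
    define N where "N = Suc n"
    have seg: "W (f N) - W (f 0) = (\<Sum>i<N. c (f i) (f (Suc i)))"
      if "\<And>i. i \<le> N \<Longrightarrow> f i \<in> Q" "\<And>i. dist (f i) (f (Suc i)) = inverse (real N)" for f
    proof -
      have "(\<Sum>i<N. c (f i) (f (Suc i))) = (\<Sum>i<N. W (f (Suc i)) - W (f i))"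
        using that n by (intro sum.cong W[symmetric]) (auto simp: N_def)
      then show ?thesis using sum_lessThan_telescope[of "\<lambda>i. W (f i)" N] by simp
    qed
    have sc: "real i / real N \<in> {0..1}" if "i \<le> N" for i using that by (auto simp: N_def)
    have ds: "dist (real i / real N) (real (Suc i) / real N) = inverse (real N)" for i
      by (simp add: dist_real_def diff_divide_distrib[symmetric] inverse_eq_divide)
    have side: "W (1, s) - W (0, s) = (\<Sum>i<N. c (real i / real N, s) (real (Suc i) / real N, s))" if "s \<in> {0..1}" for s
      using seg[of "\<lambda>i. (real i / real N, s)"] sc that ds by (simp add: Q_def N_def dist_Pair_Pair)
    have "W (1, 1) - W (1, 0) = (\<Sum>i<N. c (1, real i / real N) (1, real (Suc i) / real N))"
      using seg[of "\<lambda>i. (1, real i / real N)"] sc ds by (simp add: Q_def N_def dist_Pair_Pair)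
    also have "\<dots> = 0"
      by (intro sum.neutral) (use sc in \<open>auto simp: c_def h1\<close>)
    finally have "W (1, 1) = W (1, 0)" by simp
    moreover have "W (1, 1) - W (0, 1) = W (1, 0) - W (0, 0)"
      unfolding side[of 1, simplified] side[of 0, simplified]
      by (intro sum.cong) (use sc in \<open>auto simp: c_def hloop\<close>)
    ultimately show ?thesis by simp
  qed

  obtain v where v: "\<And>x y. 0 \<le> x \<Longrightarrow> x \<le> y \<Longrightarrow> y \<le> 1 \<Longrightarrow> dist (\<gamma> x) (\<gamma> y) \<le> v y - v x"
    using rectifiable_variation_function[OF rect] by blast
  have V0: "0 \<le> v 1 - v 0" using v[of 0 1] zero_le_dist[of "\<gamma> 0" "\<gamma> 1"] by linarith
  have img: "path_image \<gamma> \<subseteq> G"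
    using homotopic_loops_imp_subset[OF hom] by simp
  define J where "J j = line_integral (P j) \<gamma> j" for j
  have J: "has_stieltjes_integral (\<lambda>t. P j (\<gamma> t)) (\<lambda>t. \<gamma> t $ j) (J j)" for j
    unfolding J_def using rect cont[of j] img
    by (intro has_stieltjes_integral_line_integral) (auto intro: continuous_on_subset)
  \<comment> \<open>A compact neighbourhood of the image of the homotopy; the coefficients are uniformly continuous on it.\<close>
  define T where "T = {x + y |x y. x \<in> h ` Q \<and> y \<in> cball 0 (r / 2)}"
  have "compact T" unfolding T_def using cKc by (intro compact_sums) auto
  have T_in: "x \<in> T" if "p \<in> h ` Q" "dist p x \<le> r / 2" for p x
    unfolding T_def using that by (intro CollectI exI[of _ p] exI[of _ "x - p"]) (auto simp: dist_norm norm_minus_commute)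
  have "T \<subseteq> G"
  proof
    fix x assume "x \<in> T"
    then obtain p y where "p \<in> h ` Q" "x = p + y" "norm y \<le> r / 2" by (auto simp: T_def)
    then have "x \<in> ball p r" using r(1) by (auto simp: dist_norm)
    then show "x \<in> G" using r(2) \<open>p \<in> h ` Q\<close> by blast
  qed
  have "\<bar>\<Sum>j\<in>UNIV. J j\<bar> \<le> \<epsilon>" if "0 < \<epsilon>" for \<epsilon>
  proof -
    define k where "k = real CARD('k)"
    have "0 < k" by (simp add: k_def)
    define \<eta> where "\<eta> = \<epsilon> / (2 * k * (v 1 - v 0 + 1))"
    have "0 < \<eta>" using \<open>0 < \<epsilon>\<close> \<open>0 < k\<close> V0 by (simp add: \<eta>_def)
    have "\<exists>s>0. \<forall>x\<in>T. \<forall>y\<in>T. dist x y < s \<longrightarrow> \<bar>P j x - P j y\<bar> < \<eta>" for j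
    proof -
      have "uniformly_continuous_on T (P j)"
        using \<open>compact T\<close> continuous_on_subset[OF cont \<open>T \<subseteq> G\<close>] by (intro compact_uniformly_continuous)
      then show ?thesis using \<open>0 < \<eta>\<close> unfolding uniformly_continuous_on_def dist_real_def
        by (metis dist_commute)
    qed
    then obtain s where s: "\<And>j. 0 < s j" "\<And>j x y. x \<in> T \<Longrightarrow> y \<in> T \<Longrightarrow> dist x y < s j \<Longrightarrow> \<bar>P j x - P j y\<bar> < \<eta>"
      by metis
    define \<sigma> where "\<sigma> = min (r / 2) (Min (range s) / 2)"
    have "0 < \<sigma>" "\<sigma> \<le> r / 2"
      using s(1) r(1) by (auto simp: \<sigma>_def)
    have \<sigma>s: "2 * \<sigma> \<le> s j" for j
    proof -
      have "Min (range s) \<le> s j" by (intro Min_le) auto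
      moreover have "\<sigma> \<le> Min (range s) / 2" unfolding \<sigma>_def by (rule min.cobounded2)
      ultimately show ?thesis by linarith
    qed
    have "uniformly_continuous_on {0..1} \<gamma>"
      using rect unfolding rectifiable_def path_def by (intro compact_uniformly_continuous) auto
    then obtain d' where d': "0 < d'" "\<And>x y. x \<in> {0..1} \<Longrightarrow> y \<in> {0..1} \<Longrightarrow> dist x y < d' \<Longrightarrow> dist (\<gamma> x) (\<gamma> y) < \<sigma>"
      using \<open>0 < \<sigma>\<close> unfolding uniformly_continuous_on_def by (metis dist_commute)
    \<comment> \<open>Mean value inequality for the local primitive minus the linear form frozen at the tag \<open>\<gamma> t\<close>.\<close>
    have cell: "\<bar>(\<Sum>j\<in>UNIV. P j (\<gamma> t) * (\<gamma> y $ j - \<gamma> x $ j)) - (W (0, y) - W (0, x))\<bar> \<le> k * \<eta> * (v y - v x)"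
      if txy: "0 \<le> x" "x \<le> t" "t \<le> y" "y \<le> 1" "y - x < min (d / 2) d'" for x y t
    proof -
      have inQ: "(0, x) \<in> Q" "(0, y) \<in> Q" "(0, t) \<in> Q" using txy by (auto simp: Q_def)
      have hx: "h (0, x) = \<gamma> x" "h (0, y) = \<gamma> y" "h (0, t) = \<gamma> t" using txy by (auto intro!: h0)
      have inK: "\<gamma> x \<in> h ` Q" "\<gamma> t \<in> h ` Q" using inQ hx by (metis image_eqI)+
      have near: "dist (\<gamma> x) (\<gamma> y) < \<sigma>" "dist (\<gamma> x) (\<gamma> t) < \<sigma>"
        using txy by (auto intro!: d'(2) simp: dist_real_def)
      have "W (0, y) - W (0, x) = V (\<gamma> x) (\<gamma> y) - V (\<gamma> x) (\<gamma> x)"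
        using W[OF inQ(1,2)] txy by (simp add: c_def hx dist_Pair_Pair dist_real_def)
      moreover have "\<omega> (\<gamma> t) (\<gamma> y - \<gamma> x) = \<omega> (\<gamma> t) (\<gamma> y) - \<omega> (\<gamma> t) (\<gamma> x)"
        by (simp add: \<omega>_def algebra_simps sum_subtractf)
      moreover have "norm ((V (\<gamma> x) (\<gamma> y) - \<omega> (\<gamma> t) (\<gamma> y)) - (V (\<gamma> x) (\<gamma> x) - \<omega> (\<gamma> t) (\<gamma> x))) \<le> (k * \<eta>) * norm (\<gamma> y - \<gamma> x)"
      proof (rule differentiable_bound[where S = "ball (\<gamma> x) \<sigma>" and f' = "\<lambda>z h. \<omega> z h - \<omega> (\<gamma> t) h"])
        show "\<gamma> y \<in> ball (\<gamma> x) \<sigma>" "\<gamma> x \<in> ball (\<gamma> x) \<sigma>" using near \<open>0 < \<sigma>\<close> by auto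
        fix z assume z: "z \<in> ball (\<gamma> x) \<sigma>"
        have lin: "bounded_linear (\<omega> (\<gamma> t))" unfolding \<omega>_def
          by (intro bounded_linear_sum bounded_linear_const_mult bounded_linear_vec_nth)
        have "(V (\<gamma> x) has_derivative \<omega> z) (at z)"
          using z \<open>\<sigma> \<le> r / 2\<close> r(1) by (intro V[OF inK(1)]) auto
        then show "((\<lambda>z. V (\<gamma> x) z - \<omega> (\<gamma> t) z) has_derivative (\<lambda>h. \<omega> z h - \<omega> (\<gamma> t) h)) (at z within ball (\<gamma> x) \<sigma>)"
          by (rule has_derivative_at_withinI[OF has_derivative_diff[OF _ bounded_linear_imp_has_derivative[OF lin]]])
        have zt: "z \<in> T" "\<gamma> t \<in> T"
          using z \<open>\<sigma> \<le> r / 2\<close> r(1) by (auto intro: T_in[OF inK(1)] T_in[OF inK(2)])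
        have "dist z (\<gamma> t) < 2 * \<sigma>"
          using dist_triangle2[of z "\<gamma> t" "\<gamma> x"] dist_triangle3[of z "\<gamma> t" "\<gamma> x"] z near by (simp add: dist_commute)
        then have Pz: "\<bar>P j z - P j (\<gamma> t)\<bar> \<le> \<eta>" for j
          using s(2)[OF zt, of j] \<sigma>s[of j] by linarith
        show "onorm (\<lambda>h. \<omega> z h - \<omega> (\<gamma> t) h) \<le> k * \<eta>"
        proof (rule onorm_le)
          fix h :: "real ^ 'k"
          have "norm (\<omega> z h - \<omega> (\<gamma> t) h) = \<bar>\<Sum>j\<in>UNIV. (P j z - P j (\<gamma> t)) * h $ j\<bar>"
            by (simp add: \<omega>_def sum_subtractf[symmetric] left_diff_distrib)
          also have "\<dots> \<le> (\<Sum>j\<in>(UNIV::'k set). \<eta> * norm h)"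
          proof (intro order_trans[OF sum_abs] sum_mono)
            fix j show "\<bar>(P j z - P j (\<gamma> t)) * h $ j\<bar> \<le> \<eta> * norm h"
              unfolding abs_mult using Pz component_le_norm_cart \<open>0 < \<eta>\<close> by (intro mult_mono) auto
          qed
          finally show "norm (\<omega> z h - \<omega> (\<gamma> t) h) \<le> k * \<eta> * norm h"
            by (simp add: k_def)
        qed
      qed auto
      moreover have "(k * \<eta>) * norm (\<gamma> y - \<gamma> x) \<le> (k * \<eta>) * (v y - v x)"
        using v[of x y] txy \<open>0 < k\<close> \<open>0 < \<eta>\<close> by (intro mult_left_mono) (auto simp: dist_norm norm_minus_commute)
      ultimately show ?thesis
        by (simp add: \<omega>_def)
    qed
    have "0 < \<epsilon> / (2 * k)" using \<open>0 < \<epsilon>\<close> \<open>0 < k\<close> by simp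
    then have "\<exists>\<delta>>0. \<forall>p. p tagged_division_of {0..1} \<longrightarrow> mesh_below \<delta> p \<longrightarrow>
        \<bar>stieltjes_sum (\<lambda>t. P j (\<gamma> t)) (\<lambda>t. \<gamma> t $ j) p - J j\<bar> < \<epsilon> / (2 * k)" for j
      using has_stieltjes_integralE[OF J[of j]] by metis
    then obtain \<delta> where \<delta>: "\<And>j. 0 < \<delta> j" "\<And>j p. p tagged_division_of {0..1} \<Longrightarrow> mesh_below (\<delta> j) p \<Longrightarrow>
        \<bar>stieltjes_sum (\<lambda>t. P j (\<gamma> t)) (\<lambda>t. \<gamma> t $ j) p - J j\<bar> < \<epsilon> / (2 * k)"
      by metis
    define \<mu> where "\<mu> = min (Min (range \<delta>)) (min (d / 2) d')"
    have "0 < \<mu>" using \<delta>(1) d(1) d'(1) by (simp add: \<mu>_def)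
    then obtain p where p: "p tagged_division_of {0..1}" "mesh_below \<mu> p"
      by (rule fine_tagged_division)
    have "\<mu> \<le> \<delta> j" for j unfolding \<mu>_def by (intro min.coboundedI1 Min_le) auto
    then have 1: "\<bar>stieltjes_sum (\<lambda>t. P j (\<gamma> t)) (\<lambda>t. \<gamma> t $ j) p - J j\<bar> < \<epsilon> / (2 * k)" for j
      using p by (intro \<delta>(2)) (auto elim: mesh_below_mono)
    define R where "R = (\<Sum>j\<in>UNIV. stieltjes_sum (\<lambda>t. P j (\<gamma> t)) (\<lambda>t. \<gamma> t $ j) p)"
    have "\<bar>R - (\<Sum>j\<in>UNIV. J j)\<bar> \<le> (\<Sum>j\<in>(UNIV::'k set). \<epsilon> / (2 * k))"
      unfolding R_def sum_subtractf[symmetric] using 1 by (intro order_trans[OF sum_abs] sum_mono less_imp_le)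
    also have "\<dots> = \<epsilon> / 2" using \<open>0 < k\<close> by (simp add: k_def)
    finally have 2: "\<bar>R - (\<Sum>j\<in>UNIV. J j)\<bar> \<le> \<epsilon> / 2" .
    have R: "R = (\<Sum>(t, K)\<in>p. \<Sum>j\<in>UNIV. P j (\<gamma> t) * (\<gamma> (Sup K) $ j - \<gamma> (Inf K) $ j))"
      unfolding R_def stieltjes_sum_def case_prod_unfold by (rule sum.swap)
    have "(\<Sum>(t, K)\<in>p. W (0, Sup K) - W (0, Inf K)) = 0"
      using additive_tagged_division_1[OF _ p(1), of "\<lambda>t. W (0, t)"] loop by simp
    then have "\<bar>R\<bar> = \<bar>\<Sum>(t, K)\<in>p. (\<Sum>j\<in>UNIV. P j (\<gamma> t) * (\<gamma> (Sup K) $ j - \<gamma> (Inf K) $ j)) - (W (0, Sup K) - W (0, Inf K))\<bar>"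
      unfolding R case_prod_unfold sum_subtractf by simp
    also have "\<dots> \<le> (\<Sum>(t, K)\<in>p. k * \<eta> * (v (Sup K) - v (Inf K)))"
      unfolding case_prod_unfold
    proof (rule order_trans[OF sum_abs sum_mono])
      fix z assume "z \<in> p"
      then obtain t K where tK: "z = (t, K)" "(t, K) \<in> p" by (cases z) auto
      note K = tagged_cell_real[OF p(1) tK(2)]
      have "Sup K - Inf K = diameter {Inf K..Sup K}" using K(6) by simp
      also have "\<dots> < \<mu>" using K(1) p(2) tK(2) by (auto simp: mesh_below_def)
      also have "\<mu> \<le> min (d / 2) d'" unfolding \<mu>_def by (rule min.cobounded2)
      finally show "\<bar>(\<Sum>j\<in>UNIV. P j (\<gamma> (fst z)) * (\<gamma> (Sup (snd z)) $ j - \<gamma> (Inf (snd z)) $ j)) - (W (0, Sup (snd z)) - W (0, Inf (snd z)))\<bar>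
          \<le> k * \<eta> * (v (Sup (snd z)) - v (Inf (snd z)))"
        unfolding tK(1) fst_conv snd_conv by (intro cell K)
    qed
    also have "\<dots> = k * \<eta> * (v 1 - v 0)"
      using additive_tagged_division_1[OF _ p(1), of v] by (simp add: sum_distrib_left[symmetric] case_prod_unfold)
    also have "\<dots> \<le> k * \<eta> * (v 1 - v 0 + 1)" using \<open>0 < k\<close> \<open>0 < \<eta>\<close> by simp
    also have "\<dots> = \<epsilon> / 2"
    proof -
      have "v 1 - v 0 + 1 \<noteq> 0" using V0 by linarith
      then show ?thesis unfolding \<eta>_def using \<open>0 < k\<close> by (simp add: divide_simps)
    qed
    finally show ?thesis using 2 by linarith
  qed
  then have "\<bar>\<Sum>j\<in>UNIV. J j\<bar> \<le> 0" by (rule field_le_epsilon[of _ 0, simplified])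
  then show ?thesis by (simp add: J_def)
qed

section \<open>Triangular multiplication and principal extensions\<close>

lemma has_derivative_imp_directional_limit:
  fixes f :: "'v::real_normed_vector \<Rightarrow> complex"
  assumes "(f has_derivative f') (at x)"
  shows "((\<lambda>t. (f (x + t *\<^sub>R h) - f x) / of_real t) \<longlongrightarrow> f' h) (at_right 0)"
proof -
  have lin: "bounded_linear f'" using assms by (rule has_derivative_bounded_linear)
  have "((\<lambda>t. f (x + t *\<^sub>R h)) has_derivative (\<lambda>t. f' (t *\<^sub>R h))) (at 0)"
    by (rule has_derivative_compose[where g = f]) (auto intro!: derivative_eq_intros assms)
  then have d: "((\<lambda>t. f (x + t *\<^sub>R h)) has_derivative (\<lambda>t. t *\<^sub>R f' h)) (at 0)"
    using linear_scale[OF bounded_linear.linear[OF lin]] by simp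
  have "((\<lambda>t. (\<rho> (f (x + t *\<^sub>R h)) - \<rho> (f x)) / t) \<longlongrightarrow> \<rho> (f' h)) (at_right 0)"
    if "bounded_linear \<rho>" for \<rho> :: "complex \<Rightarrow> real"
  proof -
    interpret \<rho>: bounded_linear \<rho> by fact
    have "((\<lambda>t. \<rho> (f (x + t *\<^sub>R h))) has_derivative (\<lambda>t. \<rho> (t *\<^sub>R f' h))) (at 0)"
      by (rule \<rho>.has_derivative[OF d])
    then have "((\<lambda>t. \<rho> (f (x + t *\<^sub>R h))) has_real_derivative \<rho> (f' h)) (at 0)"
      by (simp add: has_field_derivative_def \<rho>.scaleR mult.commute[of _ "\<rho> (f' h)"])
    then have "((\<lambda>t. (\<rho> (f (x + t *\<^sub>R h)) - \<rho> (f x)) / t) \<longlongrightarrow> \<rho> (f' h)) (at 0)"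
      by (simp add: DERIV_def)
    then show ?thesis by (rule tendsto_within_subset) auto
  qed
  from this[OF bounded_linear_Re] this[OF bounded_linear_Im] show ?thesis
    by (simp add: tendsto_complex_iff)
qed

context cartan_algebra
begin

lemma coord_add: "coord q (a + b) = coord q a + coord q b"
  by (simp add: coord_def representation_add[OF basis_independent] basis_span del: One_nat_def)

lemma coord_scale: "coord q (scale c a) = c * coord q a"
  by (simp add: coord_def representation_scale[OF basis_independent] basis_span del: One_nat_def)

lemma coord_0 [simp]: "coord q 0 = 0"
  by (simp add: coord_def representation_zero)

lemma coord_diff: "coord q (a - b) = coord q a - coord q b"
  using coord_add[of q "a - b" b] by simp

lemma coord_sum: "coord q (\<Sum>x\<in>A. F x) = (\<Sum>x\<in>A. coord q (F x))"
  by (induction A rule: infinite_finite_induct) (auto simp: coord_add)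

lemma basis_expansion: "(\<Sum>r = 1..n. scale (coord r a) (I r)) = a"
proof -
  have "(\<Sum>b\<in>I ` {1..n}. scale (representation (I ` {1..n}) a b) b) = a"
    by (rule sum_representation_eq[OF basis_independent]) (auto simp: basis_span simp del: One_nat_def)
  then show ?thesis
    by (simp add: sum.reindex[OF basis_inj] coord_def del: One_nat_def)
qed

lemma coord_eqI: "a = b" if "\<And>q. q \<in> {1..n} \<Longrightarrow> coord q a = coord q b"
proof -
  have "(\<Sum>r = 1..n. scale (coord r a) (I r)) = (\<Sum>r = 1..n. scale (coord r b) (I r))"
    by (intro sum.cong) (use that in auto)
  then show ?thesis by (simp only: basis_expansion)
qed

lemma scale_mult_right: "scale c (a * b) = a * scale c b"
  using scale_mult_left[of c b a] by (simp add: mult.commute)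

lemma coord_mult_right: "coord q (a * b) = (\<Sum>r = 1..n. coord r b * coord q (a * I r))"
proof -
  have "a * b = (\<Sum>r = 1..n. scale (coord r b) (a * I r))"
    by (subst basis_expansion[of b, symmetric]) (simp add: sum_distrib_left scale_mult_right del: One_nat_def)
  then show ?thesis by (simp add: coord_sum coord_scale del: One_nat_def)
qed

lemma coord_mult: "coord q (a * b) = (\<Sum>t = 1..n. \<Sum>r = 1..n. coord r a * coord t b * coord q (I r * I t))"
proof -
  have "coord q (a * I t) = (\<Sum>r = 1..n. coord r a * coord q (I r * I t))" for t
    using coord_mult_right[of q "I t" a] by (simp add: mult.commute del: One_nat_def)
  then show ?thesis
    by (subst coord_mult_right) (simp add: sum_distrib_left mult_ac del: One_nat_def)
qed

text \<open>The index \<open>u\<close> with \<open>I u * I s = I s\<close>. It names the local summand of the algebra that contains \<open>I s\<close>.\<close>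

definition component :: "nat \<Rightarrow> nat" where
  "component s = (if s \<le> m then s else THE u. u \<in> {1..m} \<and> (\<forall>r\<in>{1..m}. I r * I s = (if r = u then I s else 0)))"

lemma component:
  assumes "s \<in> {1..n}"
  shows "component s \<in> {1..m}" "r \<in> {1..m} \<Longrightarrow> I r * I s = (if r = component s then I s else 0)"
proof -
  have "component s \<in> {1..m} \<and> (\<forall>r\<in>{1..m}. I r * I s = (if r = component s then I s else 0))"
  proof (cases "s \<le> m")
    case True
    then show ?thesis using assms idempotents by (auto simp: component_def)
  next
    case False
    then have eq: "component s = (THE u. u \<in> {1..m} \<and> (\<forall>r\<in>{1..m}. I r * I s = (if r = u then I s else 0)))"
      by (simp only: component_def if_False)
    show ?thesis
      unfolding eq by (rule theI'[OF idempotent_nilpotent]) (use False assms in auto)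
  qed
  then show "component s \<in> {1..m}" "r \<in> {1..m} \<Longrightarrow> I r * I s = (if r = component s then I s else 0)" by blast+
qed

text \<open>Multiplication by \<open>I r\<close> is triangular with respect to the Cartan basis, and its diagonal entry at \<open>s\<close>
  is \<open>1\<close> precisely when \<open>I r\<close> is the idempotent of the local summand of \<open>I s\<close>.\<close>

lemma coord_basis_mult:
  assumes "r \<in> {1..n}" "s \<in> {1..n}" "q \<in> {1..n}" "q \<le> s"
  shows "coord q (I r * I s) = (if q = s \<and> r = component s then 1 else 0)"
proof (cases "r \<le> m")
  case True
  then show ?thesis
    using component(2)[OF assms(2), of r] assms by (auto simp: coord_basis)
next
  case r: False
  have ne: "r \<noteq> component s" using component(1)[OF assms(2)] r by auto
  show ?thesis
  proof (cases "s \<le> m")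
    case True
    then have "I r * I s = (if s = component r then I r else 0)"
      using component(2)[OF assms(1), of s] assms by (simp add: mult.commute)
    then show ?thesis using ne assms r True by (auto simp: coord_basis)
  next
    case False
    then have "coord q (I r * I s) = (\<Sum>p = max r s + 1..n. \<Upsilon> r p s * coord q (I p))"
      using r assms by (simp add: nilpotents coord_sum coord_scale)
    also have "\<dots> = 0"
      using assms by (intro sum.neutral) (auto simp: coord_basis)
    finally show ?thesis using ne by simp
  qed
qed

lemma coord_basis_mult_idempotent:
  assumes "r \<in> {1..n}" "s \<in> {1..n}" "q \<in> {1..m}"
  shows "coord q (I r * I s) = (if r = q \<and> s = q then 1 else 0)"
proof (cases "q \<le> s")
  case True
  have "component q = q" using assms by (simp add: component_def)
  then show ?thesis using coord_basis_mult[of r s q] assms True m_le_n by auto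
next
  case False
  then have "I r * I s = (if s = component r then I r else 0)"
    using component(2)[OF assms(1), of s] assms m_le_n by (simp add: mult.commute)
  moreover have "s = component q \<Longrightarrow> s = q" using assms by (simp add: component_def)
  ultimately show ?thesis using assms False m_le_n by (auto simp: coord_basis)
qed

text \<open>The first \<open>m\<close> coordinates are the multiplicative functionals of the algebra.\<close>

lemma coord_mult_idempotent:
  assumes "q \<in> {1..m}"
  shows "coord q (a * b) = coord q a * coord q b"
proof -
  have "coord q (a * b) = (\<Sum>t = 1..n. \<Sum>r = 1..n. if r = q then (if t = q then coord r a * coord t b else 0) else 0)"
    by (subst coord_mult, intro sum.cong refl) (use assms in \<open>auto simp: coord_basis_mult_idempotent\<close>)
  also have "\<dots> = coord q a * coord q b"
    using assms m_le_n by (simp add: sum.delta')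
  finally show ?thesis .
qed

lemma coord_1_idempotent: "q \<in> {1..m} \<Longrightarrow> coord q 1 = 1"
  using m_le_n by (simp add: one_eq coord_sum coord_basis sum.delta' del: sum.cl_ivl_Suc)

lemma coord_power_idempotent: "q \<in> {1..m} \<Longrightarrow> coord q (a ^ p) = coord q a ^ p"
  by (induction p) (auto simp: coord_1_idempotent coord_mult_idempotent)

text \<open>For \<open>1 \<le> s \<le> n\<close> this is the span of \<open>I s, \<dots>, I n\<close>; for \<open>s = n + 1\<close> it is zero, and for \<open>s = m + 1\<close> the radical.
  By triangularity all these subspaces are ideals.\<close>

definition filtration :: "nat \<Rightarrow> 'a set" where
  "filtration s = {b. \<forall>q\<in>{1..n}. q < s \<longrightarrow> coord q b = 0}"

text \<open>On the one-dimensional quotient of \<open>filtration s\<close> by \<open>filtration (s + 1)\<close> an element \<open>a\<close> acts as the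
  scalar \<open>coord (component s) a\<close>. This is what reduces the theorem to scalar functions.\<close>

lemma coord_mult_filtration:
  assumes "b \<in> filtration s" "q \<in> {1..n}" "q \<le> s"
  shows "coord q (a * b) = (if q = s then coord (component s) a * coord s b else 0)"
proof -
  have "coord q (a * b) = (\<Sum>t = 1..n. \<Sum>r = 1..n.
      if r = component s then (if t = q then (if q = s then coord r a * coord t b else 0) else 0) else 0)"
  proof (subst coord_mult, intro sum.cong refl)
    fix t r assume tr: "t \<in> {1..n}" "r \<in> {1..n}"
    show "coord r a * coord t b * coord q (I r * I t)
        = (if r = component s then (if t = q then (if q = s then coord r a * coord t b else 0) else 0) else 0)"
    proof (cases "t < s")
      case True
      then show ?thesis using assms(1) tr by (auto simp: filtration_def)
    next
      case False
      then show ?thesis using coord_basis_mult[of r t q] tr assms by auto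
    qed
  qed
  also have "\<dots> = (if q = s then coord (component s) a * coord s b else 0)"
  proof (cases "q = s")
    case True
    then show ?thesis using assms(2) component(1)[of s] m_le_n by (simp add: sum.delta')
  next
    case False
    then show ?thesis by (simp cong: if_cong)
  qed
  finally show ?thesis .
qed

lemma filtration_mult: "b \<in> filtration s \<Longrightarrow> a * b \<in> filtration s"
  by (simp add: filtration_def[of s] del: One_nat_def) (simp add: coord_mult_filtration[unfolded filtration_def, of b s] del: One_nat_def)

text \<open>For \<open>a\<close> in the radical that scalar is zero. Consequently the \<open>n\<close>-th power of \<open>a\<close> vanishes.\<close>

lemma filtration_gain:
  assumes "a \<in> filtration (m + 1)" "b \<in> filtration s"
  shows "a * b \<in> filtration (s + 1)"
  unfolding filtration_def
proof (intro CollectI ballI impI)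
  fix q assume q: "q \<in> {1..n}" "q < s + 1"
  have "coord (component s) a = 0" if "q = s"
    using assms(1) component(1)[of s] q that m_le_n by (auto simp: filtration_def)
  then show "coord q (a * b) = 0"
    using coord_mult_filtration[OF assms(2) q(1), of a] q(2) by auto
qed

lemma filtration_power: "a \<in> filtration (m + 1) \<Longrightarrow> a ^ p \<in> filtration (p + 1)"
proof (induction p)
  case 0
  show ?case by (auto simp: filtration_def)
next
  case (Suc p)
  then show ?case using filtration_gain[of a "a ^ p" "p + 1"] by simp
qed

lemma filtration_top: "a \<in> filtration (n + 1) \<Longrightarrow> a = 0"
  by (rule coord_eqI) (auto simp: filtration_def)

lemma basis_in_filtration: "s \<in> {1..n} \<Longrightarrow> I s \<in> filtration s"
  by (auto simp: filtration_def coord_basis)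

text \<open>The component of \<open>a\<close> in the local summand \<open>u\<close>, with its scalar part removed.\<close>

definition radical_part :: "nat \<Rightarrow> 'a \<Rightarrow> 'a" where
  "radical_part u a = I u * (a - scale (coord u a) 1)"

lemma radical_part_in_filtration:
  assumes "u \<in> {1..m}"
  shows "radical_part u a \<in> filtration (m + 1)"
  using assms m_le_n
  by (auto simp: filtration_def radical_part_def coord_mult_idempotent coord_diff coord_scale coord_1_idempotent coord_basis)

text \<open>The Taylor expansion of a holomorphic function at the scalar \<open>coord u a\<close> in the nilpotent
  increment \<open>radical_part u a\<close>, where \<open>g p\<close> stands for the \<open>p\<close>-th derivative. Terms with \<open>p \<ge> n\<close> would
  vanish. A family \<open>g\<close> is used instead of iterated derivatives of one function because a primitive
  can then be put in front of the family.\<close>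

definition principal_extension :: "(nat \<Rightarrow> complex \<Rightarrow> complex) \<Rightarrow> nat \<Rightarrow> 'a \<Rightarrow> 'a" where
  "principal_extension g u a = (\<Sum>p<n. scale (g p (coord u a) / fact p) (radical_part u a ^ p))"

lemma coord_basis_mult_principal_extension:
  assumes "s \<in> {1..n}"
  shows "coord s (I s * principal_extension g (component s) a) = g 0 (coord (component s) a)"
proof -
  let ?u = "component s"
  have u: "?u \<in> {1..m}" using component(1)[OF assms] .
  have "coord ?u (radical_part ?u a) = 0"
    using radical_part_in_filtration[OF u, of a] u m_le_n by (auto simp: filtration_def)
  then have "coord ?u (principal_extension g ?u a) = (\<Sum>p<n. if p = 0 then g 0 (coord ?u a) else 0)"
    unfolding principal_extension_def coord_sum coord_scale coord_power_idempotent[OF u]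
    by (intro sum.cong) auto
  also have "\<dots> = g 0 (coord ?u a)"
    using m_pos m_le_n by (simp add: sum.delta)
  finally have "coord ?u (principal_extension g ?u a) = g 0 (coord ?u a)" .
  moreover have "coord s (principal_extension g ?u a * I s) = coord ?u (principal_extension g ?u a) * coord s (I s)"
    using coord_mult_filtration[OF basis_in_filtration[OF assms], of s] assms by simp
  ultimately show ?thesis using assms by (simp add: mult.commute coord_basis)
qed

text \<open>The Frechet derivative; in finite dimension it can be taken coordinatewise.\<close>

definition has_alg_derivative :: "('v::real_normed_vector \<Rightarrow> 'a) \<Rightarrow> ('v \<Rightarrow> 'a) \<Rightarrow> 'v \<Rightarrow> bool" where
  "has_alg_derivative F F' x \<longleftrightarrow>
     (\<forall>q\<in>{1..n}. ((\<lambda>x. coord q (F x)) has_derivative (\<lambda>h. coord q (F' h))) (at x))"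

lemma has_alg_derivative_add:
  "has_alg_derivative F F' x \<Longrightarrow> has_alg_derivative G G' x \<Longrightarrow> has_alg_derivative (\<lambda>x. F x + G x) (\<lambda>h. F' h + G' h) x"
  unfolding has_alg_derivative_def coord_add by (intro ballI has_derivative_add) auto

lemma has_alg_derivative_sum:
  "(\<And>i. i \<in> A \<Longrightarrow> has_alg_derivative (F i) (F' i) x) \<Longrightarrow> has_alg_derivative (\<lambda>x. \<Sum>i\<in>A. F i x) (\<lambda>h. \<Sum>i\<in>A. F' i h) x"
  unfolding has_alg_derivative_def coord_sum by (intro ballI has_derivative_sum) auto

lemma has_alg_derivative_const: "has_alg_derivative (\<lambda>x. c) (\<lambda>h. 0) x"
  unfolding has_alg_derivative_def by simp

lemma has_alg_derivative_mult:
  assumes "has_alg_derivative F F' x" "has_alg_derivative G G' x"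
  shows "has_alg_derivative (\<lambda>x. F x * G x) (\<lambda>h. F x * G' h + F' h * G x) x"
  unfolding has_alg_derivative_def
proof
  fix q assume "q \<in> {1..n}"
  have "((\<lambda>x. \<Sum>t = 1..n. \<Sum>r = 1..n. coord r (F x) * coord t (G x) * coord q (I r * I t)) has_derivative
      (\<lambda>h. \<Sum>t = 1..n. \<Sum>r = 1..n. (coord r (F x) * coord t (G' h) + coord r (F' h) * coord t (G x)) * coord q (I r * I t))) (at x)"
    using assms unfolding has_alg_derivative_def
    by (intro has_derivative_sum has_derivative_mult_left has_derivative_mult) auto
  then show "((\<lambda>x. coord q (F x * G x)) has_derivative (\<lambda>h. coord q (F x * G' h + F' h * G x))) (at x)"
    by (simp only: coord_mult[of q "F _" "G _"] coord_mult[of q "F x" "G' _"] coord_mult[of q "F' _" "G x"] coord_add sum.distrib distrib_right)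
qed

lemma has_alg_derivative_scale:
  assumes "(g has_derivative g') (at x)" "has_alg_derivative F F' x"
  shows "has_alg_derivative (\<lambda>x. scale (g x) (F x)) (\<lambda>h. scale (g x) (F' h) + scale (g' h) (F x)) x"
  using assms unfolding has_alg_derivative_def coord_scale coord_add
  by (intro ballI has_derivative_mult) auto

lemma has_alg_derivative_power:
  assumes "has_alg_derivative F F' x"
  shows "has_alg_derivative (\<lambda>x. F x ^ Suc p) (\<lambda>h. scale (of_nat (Suc p)) (F x ^ p * F' h)) x"
proof (induction p)
  case 0
  show ?case using assms by simp
next
  case (Suc p)
  have "has_alg_derivative (\<lambda>x. F x * F x ^ Suc p)
      (\<lambda>h. F x * scale (of_nat (Suc p)) (F x ^ p * F' h) + F' h * F x ^ Suc p) x"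
    by (rule has_alg_derivative_mult[OF assms Suc.IH])
  moreover have "F x * scale (of_nat (Suc p)) (F x ^ p * F' h) + F' h * F x ^ Suc p
      = scale (of_nat (Suc (Suc p))) (F x ^ Suc p * F' h)" for h
  proof -
    have "F x * scale c (F x ^ p * F' h) = scale c (F x ^ Suc p * F' h)" for c
      by (simp add: scale_mult_right[symmetric] mult.assoc)
    moreover have "scale (of_nat (Suc (Suc p))) X = scale (of_nat (Suc p)) X + X" for X
      by (subst of_nat_Suc) (simp only: scale_left_distrib scale_one add.commute)
    ultimately show ?thesis by (simp only: mult.commute)
  qed
  ultimately show ?case by (simp only: power_Suc)
qed

lemma coord_point: "coord q (point e x) = (\<Sum>j\<in>UNIV. of_real (x $ j) * coord q (e j))"
  by (simp add: point_def coord_sum coord_scale)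

lemma bounded_linear_coord_point: "bounded_linear (\<lambda>x. coord q (point e x))"
  unfolding coord_point
  by (intro bounded_linear_sum bounded_linear_mult_const bounded_linear_compose[OF bounded_linear_of_real bounded_linear_vec_nth])

lemma has_alg_derivative_point: "has_alg_derivative (point e) (point e) x"
  unfolding has_alg_derivative_def
  by (intro ballI bounded_linear_imp_has_derivative bounded_linear_coord_point)

lemma has_alg_derivative_radical_part: "has_alg_derivative (\<lambda>x. radical_part u (point e x)) (\<lambda>h. radical_part u (point e h)) x"
proof -
  have sc: "((\<lambda>x. coord u (point e x)) has_derivative (\<lambda>h. coord u (point e h))) (at x)"
    by (intro bounded_linear_imp_has_derivative bounded_linear_coord_point)
  have "has_alg_derivative (\<lambda>x. I u * (point e x + scale (coord u (point e x)) (-1)))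
     (\<lambda>h. I u * (point e h + (scale (coord u (point e x)) 0 + scale (coord u (point e h)) (-1))) + 0 * (point e x + scale (coord u (point e x)) (-1))) x"
    by (intro has_alg_derivative_mult has_alg_derivative_add has_alg_derivative_scale has_alg_derivative_const
        has_alg_derivative_point sc)
  then show ?thesis by (simp add: radical_part_def)
qed

text \<open>Differentiating the powers of the nilpotent increment lowers the exponent, differentiating the
  coefficients raises the index, and after a shift of summation both give the extension of the shifted
  family. The shift produces one term too many, with an \<open>(n - 1)\<close>-st power of the radical times a
  radical element; it vanishes.\<close>

lemma has_alg_derivative_principal_extension:
  assumes u: "u \<in> {1..m}"
    and der: "\<And>p. (g p has_field_derivative g (Suc p) (coord u (point e x))) (at (coord u (point e x)))"
  shows "has_alg_derivative (\<lambda>x. principal_extension g u (point e x))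
     (\<lambda>h. principal_extension (\<lambda>p. g (Suc p)) u (point e x) * (radical_part u (point e h) + scale (coord u (point e h)) 1)) x"
proof -
  define z where "z = coord u (point e x)"
  define L where "L h = coord u (point e h)" for h
  define N where "N = radical_part u (point e x)"
  define D where "D h = radical_part u (point e h)" for h
  have nz: "N \<in> filtration (m + 1)" "D h \<in> filtration (m + 1)" for h
    unfolding N_def D_def using radical_part_in_filtration[OF u] by auto
  have term_der: "has_alg_derivative (\<lambda>x. scale (g p (coord u (point e x)) / fact p) (radical_part u (point e x) ^ p))
      (\<lambda>h. (if p = 0 then 0 else scale (g p z / fact (p - 1)) (N ^ (p - 1) * D h)) + scale (g (Suc p) z / fact p * L h) (N ^ p)) x" for p
  proof -
    have L: "((\<lambda>x. coord u (point e x)) has_derivative L) (at x)"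
      unfolding L_def by (intro bounded_linear_imp_has_derivative bounded_linear_coord_point)
    have "((\<lambda>x. g p (coord u (point e x))) has_derivative (\<lambda>h. g (Suc p) z * L h)) (at x)"
      using has_derivative_compose[OF L der[of p, unfolded has_field_derivative_def]] by (simp add: z_def)
    then have gd: "((\<lambda>x. g p (coord u (point e x)) / fact p) has_derivative (\<lambda>h. g (Suc p) z / fact p * L h)) (at x)"
      by (auto intro!: derivative_eq_intros)
    have pd: "has_alg_derivative (\<lambda>x. radical_part u (point e x) ^ p) (\<lambda>h. if p = 0 then 0 else scale (of_nat p) (N ^ (p - 1) * D h)) x"
      using has_alg_derivative_power[OF has_alg_derivative_radical_part[of u e x], of "p - 1"] has_alg_derivative_const[of 1 x]
      by (cases p) (auto simp: N_def D_def simp del: of_nat_Suc power_Suc)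
    have eq: "scale (g p z / fact p) (if p = 0 then 0 else scale (of_nat p) (N ^ (p - 1) * D h))
       = (if p = 0 then 0 else scale (g p z / fact (p - 1)) (N ^ (p - 1) * D h))" for h
      by (cases p) (auto simp del: of_nat_Suc)
    show ?thesis
      using has_alg_derivative_scale[OF gd pd] unfolding z_def[symmetric] N_def[symmetric] eq .
  qed
  have "has_alg_derivative (\<lambda>x. principal_extension g u (point e x))
    (\<lambda>h. \<Sum>p<n. (if p = 0 then 0 else scale (g p z / fact (p - 1)) (N ^ (p - 1) * D h)) + scale (g (Suc p) z / fact p * L h) (N ^ p)) x"
    unfolding principal_extension_def by (intro has_alg_derivative_sum term_der)
  moreover have "(\<Sum>p<n. (if p = 0 then 0 else scale (g p z / fact (p - 1)) (N ^ (p - 1) * D h)) + scale (g (Suc p) z / fact p * L h) (N ^ p))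
     = principal_extension (\<lambda>p. g (Suc p)) u (point e x) * (D h + scale (L h) 1)" for h
  proof -
    obtain k where k: "n = Suc k" using m_pos m_le_n by (cases n) auto
    have "N ^ k * D h \<in> filtration (n + 1)"
      using filtration_gain[OF nz(2) filtration_power[OF nz(1)], of h k] k by (simp add: mult.commute)
    then have top: "N ^ k * D h = 0" by (rule filtration_top)
    have "(\<Sum>p<n. if p = 0 then 0 else scale (g p z / fact (p - 1)) (N ^ (p - 1) * D h))
       = (\<Sum>p<k. scale (g (Suc p) z / fact p) (N ^ p * D h))"
      unfolding k by (subst sum.lessThan_Suc_shift) simp
    also have "\<dots> = (\<Sum>p<n. scale (g (Suc p) z / fact p) (N ^ p * D h))"
      unfolding k by (simp add: top)
    also have "\<dots> = principal_extension (\<lambda>p. g (Suc p)) u (point e x) * D h"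
      by (simp add: principal_extension_def sum_distrib_right z_def N_def scale_mult_left)
    finally have 1: "(\<Sum>p<n. if p = 0 then 0 else scale (g p z / fact (p - 1)) (N ^ (p - 1) * D h)) = \<dots>" .
    have "(\<Sum>p<n. scale (g (Suc p) z / fact p * L h) (N ^ p)) = scale (L h) (principal_extension (\<lambda>p. g (Suc p)) u (point e x))"
      by (simp add: principal_extension_def scale_sum_right z_def N_def mult.commute)
    also have "\<dots> = principal_extension (\<lambda>p. g (Suc p)) u (point e x) * scale (L h) 1"
      by (simp add: scale_mult_right[symmetric])
    finally show ?thesis using 1 by (simp add: sum.distrib distrib_left)
  qed
  ultimately show ?thesis by (simp add: D_def L_def)
qed

text \<open>Since \<open>I s\<close> absorbs the idempotent of its own local summand, multiplying by it turns the increment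
  in \<open>has_alg_derivative_principal_extension\<close> into \<open>point e h\<close> itself. So \<open>I s\<close> times a principal extension is monogenic,
  its derivative comes from the shifted family, and a primitive comes from a family shifted the other way.\<close>

lemma has_alg_derivative_basis_principal_extension:
  assumes s: "s \<in> {1..n}"
    and der: "\<And>p. (g p has_field_derivative g (Suc p) (coord (component s) (point e x))) (at (coord (component s) (point e x)))"
  shows "has_alg_derivative (\<lambda>x. I s * principal_extension g (component s) (point e x))
     (\<lambda>h. point e h * (I s * principal_extension (\<lambda>p. g (Suc p)) (component s) (point e x))) x"
proof -
  let ?u = "component s"
  have u: "?u \<in> {1..m}" by (rule component(1)[OF s])
  have "I s * (radical_part ?u a + scale (coord ?u a) 1) = a * I s" for a
  proof -
    have "I s * radical_part ?u a = I ?u * I s * (a - scale (coord ?u a) 1)"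
      by (simp add: radical_part_def mult_ac)
    also have "\<dots> = I s * (a - scale (coord ?u a) 1)"
      using component(2)[OF s u] by simp
    finally show ?thesis by (simp add: algebra_simps)
  qed
  then have eq: "I s * (E * (radical_part ?u a + scale (coord ?u a) 1)) = a * (I s * E)" for a E
    by (metis mult.assoc mult.commute)
  show ?thesis
    using has_alg_derivative_mult[OF has_alg_derivative_const[of "I s"] has_alg_derivative_principal_extension[OF u, of g e x, OF der]]
    by (simp add: eq)
qed

end

section \<open>Primitives of monogenic functions\<close>

context cartan_subspace
begin

lemma point_axis_j1: "point e (axis j1 1) = 1"
proof -
  have "point e (axis j1 1) = (\<Sum>j\<in>UNIV. if j = j1 then e j else 0)"
    unfolding point_def by (intro sum.cong) (auto simp: axis_def)
  then show ?thesis by (simp add: e_one)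
qed

lemma surj_coord_point:
  assumes "u \<in> {1..m}"
  shows "surj (\<lambda>x. coord u (point e x))"
proof -
  have "f u = coord u" using assms m_le_n by (intro f_eq_coord) auto
  then have "coord u ` range (point e) = UNIV"
    using f_surj[OF assms] by (simp add: E_def)
  then show ?thesis by (simp add: image_image)
qed

text \<open>Monogenic functions, transported to the coordinate space and read off in the Cartan basis.\<close>

definition monogenic_coords :: "(real ^ 'k) set \<Rightarrow> (real ^ 'k \<Rightarrow> 'a) \<Rightarrow> bool" where
  "monogenic_coords B F \<longleftrightarrow> (\<forall>q\<in>{1..n}. continuous_on B (\<lambda>x. coord q (F x))) \<and>
     (\<forall>x\<in>B. \<exists>c. \<forall>h. \<forall>q\<in>{1..n}.
        ((\<lambda>t. (coord q (F (x + t *\<^sub>R h)) - coord q (F x)) / of_real t) \<longlongrightarrow> coord q (point e h * c)) (at_right 0))"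

lemma monogenic_coordsD:
  assumes "monogenic_coords B F" "x \<in> B"
  shows "\<exists>c. \<forall>h. \<forall>q\<in>{1..n}.
    ((\<lambda>t. (coord q (F (x + t *\<^sub>R h)) - coord q (F x)) / of_real t) \<longlongrightarrow> coord q (point e h * c)) (at_right 0)"
  using assms(1) unfolding monogenic_coords_def by (elim conjE) (rule bspec[OF _ assms(2)])

lemma has_alg_derivative_imp_monogenic_coords:
  assumes "\<And>x. x \<in> B \<Longrightarrow> has_alg_derivative F (\<lambda>h. point e h * F' x) x"
  shows "monogenic_coords B F"
  unfolding monogenic_coords_def
proof (intro conjI ballI)
  show "continuous_on B (\<lambda>x. coord q (F x))" if "q \<in> {1..n}" for q
    using assms that unfolding has_alg_derivative_def
    by (intro continuous_at_imp_continuous_on ballI has_derivative_continuous) blast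
  fix x assume "x \<in> B"
  then show "\<exists>c. \<forall>h. \<forall>q\<in>{1..n}.
      ((\<lambda>t. (coord q (F (x + t *\<^sub>R h)) - coord q (F x)) / of_real t) \<longlongrightarrow> coord q (point e h * c)) (at_right 0)"
    using assms[unfolded has_alg_derivative_def]
    by (intro exI[of _ "F' x"] allI ballI has_derivative_imp_directional_limit) blast
qed

lemma monogenic_coords_diff:
  assumes "monogenic_coords B F" "monogenic_coords B G"
  shows "monogenic_coords B (\<lambda>x. F x - G x)"
  unfolding monogenic_coords_def
proof (intro conjI ballI)
  show "continuous_on B (\<lambda>x. coord q (F x - G x))" if "q \<in> {1..n}" for q
    using assms that unfolding monogenic_coords_def coord_diff by (intro continuous_on_diff) blast+
  fix x assume "x \<in> B"
  obtain c where c: "\<forall>h. \<forall>q\<in>{1..n}.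
      ((\<lambda>t. (coord q (F (x + t *\<^sub>R h)) - coord q (F x)) / of_real t) \<longlongrightarrow> coord q (point e h * c)) (at_right 0)"
    using monogenic_coordsD[OF assms(1) \<open>x \<in> B\<close>] ..
  obtain d where d: "\<forall>h. \<forall>q\<in>{1..n}.
      ((\<lambda>t. (coord q (G (x + t *\<^sub>R h)) - coord q (G x)) / of_real t) \<longlongrightarrow> coord q (point e h * d)) (at_right 0)"
    using monogenic_coordsD[OF assms(2) \<open>x \<in> B\<close>] ..
  have "((\<lambda>t. (coord q (F (x + t *\<^sub>R h) - G (x + t *\<^sub>R h)) - coord q (F x - G x)) / of_real t) \<longlongrightarrow> coord q (point e h * (c - d))) (at_right 0)"
    if "q \<in> {1..n}" for h q
    using tendsto_diff[OF c[rule_format, OF that, of h] d[rule_format, OF that, of h]]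
    by (simp add: coord_diff right_diff_distrib diff_divide_distrib add_divide_distrib algebra_simps)
  then show "\<exists>c. \<forall>h. \<forall>q\<in>{1..n}.
      ((\<lambda>t. (coord q (F (x + t *\<^sub>R h) - G (x + t *\<^sub>R h)) - coord q (F x - G x)) / of_real t) \<longlongrightarrow> coord q (point e h * c)) (at_right 0)"
    by blast
qed

text \<open>The derivative of \<open>F\<close> is the limit of difference quotients in the direction of the unit, so
  it stays in \<open>filtration s\<close>. By \<open>coord_mult_filtration\<close> the leading coordinate of \<open>F\<close> therefore has the directional derivatives
  \<open>f\<^sub>u(h) c\<close> with \<open>u = component s\<close>, and the surjectivity of \<open>f\<^sub>u\<close> on \<open>E e\<close> makes the factorization
  through the plane available.\<close>

lemma leading_coord_holomorphic:
  assumes "open B" "convex B" and mono: "monogenic_coords B F"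
    and s: "s \<in> {1..n}" and filtration: "\<And>x. x \<in> B \<Longrightarrow> F x \<in> filtration s"
  obtains G where "G holomorphic_on (\<lambda>x. coord (component s) (point e x)) ` B"
    "\<And>x. x \<in> B \<Longrightarrow> coord s (F x) = G (coord (component s) (point e x))"
proof (rule directionally_differentiable_factors_holomorphically)
  show "linear (\<lambda>x. coord (component s) (point e x))"
    using bounded_linear_coord_point by (rule bounded_linear.linear)
  show "surj (\<lambda>x. coord (component s) (point e x))"
    by (rule surj_coord_point[OF component(1)[OF s]])
  show "continuous_on B (\<lambda>x. coord s (F x))"
    using mono s by (simp add: monogenic_coords_def)
  fix x assume x: "x \<in> B"
  obtain c where c: "\<forall>h. \<forall>q\<in>{1..n}.
      ((\<lambda>t. (coord q (F (x + t *\<^sub>R h)) - coord q (F x)) / of_real t) \<longlongrightarrow> coord q (point e h * c)) (at_right 0)"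
    using monogenic_coordsD[OF mono x] ..
  have "c \<in> filtration s"
    unfolding filtration_def
  proof (intro CollectI ballI impI)
    fix q assume q: "q \<in> {1..n}" "q < s"
    have "\<forall>\<^sub>F t in at_right 0. 0 = (coord q (F (x + t *\<^sub>R axis j1 1)) - coord q (F x)) / of_real t"
      using eventually_in_open_ray[OF \<open>open B\<close> x, of "axis j1 1"]
    proof eventually_elim
      case (elim t)
      then show ?case using filtration[OF elim] filtration[OF x] q by (simp add: filtration_def)
    qed
    then have "((\<lambda>t. (coord q (F (x + t *\<^sub>R axis j1 1)) - coord q (F x)) / of_real t) \<longlongrightarrow> 0) (at_right 0)"
      by (rule Lim_transform_eventually[rotated]) simp
    from tendsto_unique[OF _ this c[rule_format, OF q(1), of "axis j1 1"]] show "coord q c = 0"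
      by (simp add: point_axis_j1)
  qed
  then have "coord s (point e h * c) = coord (component s) (point e h) * coord s c" for h
    using coord_mult_filtration[of c s s] s by simp
  then show "\<exists>c. \<forall>h. ((\<lambda>t. (coord s (F (x + t *\<^sub>R h)) - coord s (F x)) / of_real t) \<longlongrightarrow> coord (component s) (point e h) * c) (at_right 0)"
    using c[rule_format, OF s] by (intro exI[of _ "coord s c"] allI) simp
qed (use assms that in auto)

text \<open>Downward induction on \<open>s\<close>, removing one coordinate at a time. If \<open>G\<close> is the holomorphic function that
  gives the leading coordinate of \<open>F\<close>, then \<open>\<Theta> = I s * principal_extension\<close> of \<open>G\<close> is monogenic with the same
  leading coordinate, and it has the primitive \<open>\<Theta>1\<close>, which is built in the same way from a primitive \<open>G1\<close> of
  \<open>G\<close> on the convex set \<open>L ` B\<close>. The difference \<open>F - \<Theta>\<close> is monogenic and lies one step lower in the filtration.\<close>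

theorem monogenic_has_primitive:
  assumes "open B" "convex B"
  shows "\<lbrakk>s \<le> n + 1; 1 \<le> s; monogenic_coords B F; \<And>x. x \<in> B \<Longrightarrow> F x \<in> filtration s\<rbrakk>
    \<Longrightarrow> \<exists>V. \<forall>x\<in>B. has_alg_derivative V (\<lambda>h. point e h * F x) x"
proof (induction s arbitrary: F rule: inc_induct)
  case base
  have "F x = 0" if "x \<in> B" for x by (rule filtration_top) (use base that in auto)
  then show ?case
    by (intro exI[of _ "\<lambda>x. 0"]) (simp add: has_alg_derivative_const)
next
  case (step s)
  then have s: "s \<in> {1..n}" by simp
  define L where "L x = coord (component s) (point e x)" for x
  have "\<exists>G. G holomorphic_on L ` B \<and> (\<forall>x\<in>B. coord s (F x) = G (L x))"
    unfolding L_def by (rule leading_coord_holomorphic[OF assms step.prems(2) s step.prems(3)]) blast+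
  then obtain G where G: "G holomorphic_on L ` B" "\<And>x. x \<in> B \<Longrightarrow> coord s (F x) = G (L x)" by blast
  have linL: "linear L"
    unfolding L_def using bounded_linear_coord_point by (rule bounded_linear.linear)
  have "open (L ` B)"
    using \<open>open B\<close> linL surj_coord_point[OF component(1)[OF s]] unfolding L_def
    by (intro open_surjective_linear_image)
  have "convex (L ` B)"
    using linL \<open>convex B\<close> by (rule convex_linear_image)
  from holomorphic_convex_primitive'[OF this \<open>open (L ` B)\<close> G(1)]
  obtain G1 where G1: "\<And>z. z \<in> L ` B \<Longrightarrow> (G1 has_field_derivative G z) (at z within L ` B)" by blast
  define g where "g p = (deriv ^^ p) G" for p
  define g1 where "g1 p = (case p of 0 \<Rightarrow> G1 | Suc p \<Rightarrow> g p)" for p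
  have dg: "(g p has_field_derivative g (Suc p) z) (at z)" if "z \<in> L ` B" for p z
    unfolding g_def using holomorphic_derivI[OF holomorphic_higher_deriv[OF G(1) \<open>open (L ` B)\<close>] \<open>open (L ` B)\<close> that]
    by simp
  have dg1: "(g1 p has_field_derivative g1 (Suc p) z) (at z)" if "z \<in> L ` B" for p z
  proof (cases p)
    case 0
    then show ?thesis
      using G1[OF that] by (simp add: g1_def g_def at_within_open[OF that \<open>open (L ` B)\<close>])
  next
    case (Suc p)
    then show ?thesis using dg[OF that, of p] by (simp add: g1_def)
  qed
  define \<Theta> where "\<Theta> x = I s * principal_extension g (component s) (point e x)" for x
  define \<Theta>1 where "\<Theta>1 x = I s * principal_extension g1 (component s) (point e x)" for x
  have d\<Theta>: "has_alg_derivative \<Theta> (\<lambda>h. point e h * (I s * principal_extension (\<lambda>p. g (Suc p)) (component s) (point e x))) x" if "x \<in> B" for x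
    unfolding \<Theta>_def using dg[of "L x"] that
    by (intro has_alg_derivative_basis_principal_extension[OF s]) (auto simp: L_def)
  have d\<Theta>1: "has_alg_derivative \<Theta>1 (\<lambda>h. point e h * \<Theta> x) x" if "x \<in> B" for x
  proof -
    have "has_alg_derivative \<Theta>1 (\<lambda>h. point e h * (I s * principal_extension (\<lambda>p. g1 (Suc p)) (component s) (point e x))) x"
      unfolding \<Theta>1_def using dg1[of "L x"] that
      by (intro has_alg_derivative_basis_principal_extension[OF s]) (auto simp: L_def)
    moreover have "(\<lambda>p. g1 (Suc p)) = g" by (simp add: g1_def)
    ultimately show ?thesis by (simp add: \<Theta>_def)
  qed
  have "\<exists>V. \<forall>x\<in>B. has_alg_derivative V (\<lambda>h. point e h * (F x - \<Theta> x)) x"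
  proof (rule step.IH)
    show "monogenic_coords B (\<lambda>x. F x - \<Theta> x)"
      using step.prems(2) has_alg_derivative_imp_monogenic_coords[of B \<Theta>, OF d\<Theta>] by (rule monogenic_coords_diff)
    show "F x - \<Theta> x \<in> filtration (Suc s)" if x: "x \<in> B" for x
      unfolding filtration_def
    proof (intro CollectI ballI impI)
      fix q assume q: "q \<in> {1..n}" "q < Suc s"
      have lead: "coord s (\<Theta> x) = G (L x)"
        unfolding \<Theta>_def coord_basis_mult_principal_extension[OF s] by (simp add: g_def L_def)
      have "\<Theta> x \<in> filtration s"
        unfolding \<Theta>_def using filtration_mult[OF basis_in_filtration[OF s]] by (simp add: mult.commute[of "I s"])
      then show "coord q (F x - \<Theta> x) = 0"
        using step.prems(3)[OF x] lead G(2)[OF x] q by (cases "q = s") (auto simp: filtration_def coord_diff)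
    qed
  qed simp
  then obtain V where V: "\<And>x. x \<in> B \<Longrightarrow> has_alg_derivative V (\<lambda>h. point e h * (F x - \<Theta> x)) x" by blast
  have "has_alg_derivative (\<lambda>x. V x + \<Theta>1 x) (\<lambda>h. point e h * F x) x" if "x \<in> B" for x
    using has_alg_derivative_add[OF V[OF that] d\<Theta>1[OF that]] by (simp add: distrib_left[symmetric])
  then show ?case by blast
qed

lemma alg_tendsto_iff_coords:
  "alg_tendsto F l \<F> \<longleftrightarrow> (\<forall>q\<in>{1..n}. ((\<lambda>x. coord q (F x)) \<longlongrightarrow> coord q l) \<F>)"
proof
  assume lim: "alg_tendsto F l \<F>"
  show "\<forall>q\<in>{1..n}. ((\<lambda>x. coord q (F x)) \<longlongrightarrow> coord q l) \<F>"
  proof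
    fix q assume q: "q \<in> {1..n}"
    have le: "norm (coord q (F x) - coord q l) \<le> alg_norm (F x - l)" for x
    proof -
      have "norm (coord q (F x) - coord q l) = sqrt ((cmod (coord q (F x - l)))\<^sup>2)"
        by (simp add: coord_diff)
      also have "\<dots> \<le> alg_norm (F x - l)"
        unfolding alg_norm_def using q by (intro real_sqrt_le_mono member_le_sum) auto
      finally show ?thesis .
    qed
    have "((\<lambda>x. coord q (F x) - coord q l) \<longlongrightarrow> 0) \<F>"
      using lim unfolding alg_tendsto_def by (rule Lim_null_comparison[rotated]) (simp add: le)
    then show "((\<lambda>x. coord q (F x)) \<longlongrightarrow> coord q l) \<F>"
      by (simp add: Lim_null[of _ "coord q l"])
  qed
next
  assume lim: "\<forall>q\<in>{1..n}. ((\<lambda>x. coord q (F x)) \<longlongrightarrow> coord q l) \<F>"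
  have "((\<lambda>x. sqrt (\<Sum>r = 1..n. (cmod (coord r (F x) - coord r l))\<^sup>2)) \<longlongrightarrow> sqrt (\<Sum>r = 1..n. (cmod (coord r l - coord r l))\<^sup>2)) \<F>"
    using lim by (intro tendsto_intros) auto
  then show "alg_tendsto F l \<F>"
    by (simp add: alg_tendsto_def alg_norm_def coord_diff)
qed

lemma point_add_scaleR: "point e (x + t *\<^sub>R h) = point e x + scale (of_real t) (point e h)"
  by (simp add: point_def scale_left_distrib sum.distrib scale_sum_right)

lemma monogenic_on_imp_monogenic_coords:
  assumes "monogenic_on e \<Omega> \<Phi>"
  shows "monogenic_coords (real_set e \<Omega>) (\<lambda>x. \<Phi> (point e x))"
  unfolding monogenic_coords_def
proof (intro conjI ballI)
  show "continuous_on (real_set e \<Omega>) (\<lambda>x. coord q (\<Phi> (point e x)))" if "q \<in> {1..n}" for q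
    using assms that unfolding monogenic_on_def alg_continuous_on_def alg_tendsto_iff_coords continuous_on_def by blast
  fix x assume "x \<in> real_set e \<Omega>"
  then have "point e x \<in> \<Omega>" by (simp add: real_set_def)
  then obtain c where c: "\<And>h. h \<in> E e \<Longrightarrow> alg_tendsto
          (\<lambda>\<epsilon>::real. scale (complex_of_real (inverse \<epsilon>)) (\<Phi> (point e x + scale (complex_of_real \<epsilon>) h) - \<Phi> (point e x)))
          (h * c) (at_right 0)"
    using assms unfolding monogenic_on_def by blast
  have "((\<lambda>t. (coord q (\<Phi> (point e (x + t *\<^sub>R h))) - coord q (\<Phi> (point e x))) / of_real t) \<longlongrightarrow> coord q (point e h * c)) (at_right 0)"
    if "q \<in> {1..n}" for h q
  proof -
    have "point e h \<in> E e" by (simp add: E_def)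
    from c[OF this] have "((\<lambda>t. coord q (scale (complex_of_real (inverse t)) (\<Phi> (point e x + scale (complex_of_real t) (point e h)) - \<Phi> (point e x)))) \<longlongrightarrow> coord q (point e h * c)) (at_right 0)"
      unfolding alg_tendsto_iff_coords using that by blast
    then show ?thesis
      by (simp add: coord_scale coord_diff point_add_scaleR divide_inverse mult.commute)
  qed
  then show "\<exists>c. \<forall>h. \<forall>q\<in>{1..n}. ((\<lambda>t. (coord q (\<Phi> (point e (x + t *\<^sub>R h))) - coord q (\<Phi> (point e x))) / of_real t) \<longlongrightarrow> coord q (point e h * c)) (at_right 0)"
    by blast
qed

text \<open>The integral is defined through the real and imaginary parts of the coordinates of \<open>\<Psi>\<close>; this regroups
  it into line integrals of the coordinates of \<open>e j * \<Psi>\<close>, which are the coefficients of the closed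
  forms to which \<open>locally_exact_line_integral_eq_0\<close> applies.\<close>

lemma coord_alg_integral:
  assumes rect: "rectifiable \<gamma>"
    and cont: "\<And>r. r \<in> {1..n} \<Longrightarrow> continuous_on (path_image \<gamma>) (\<lambda>x. coord r (\<Psi> (point e x)))"
  shows "coord q (alg_integral e \<gamma> \<Psi>) =
     Complex (\<Sum>j\<in>UNIV. line_integral (\<lambda>x. Re (coord q (e j * \<Psi> (point e x)))) \<gamma> j)
             (\<Sum>j\<in>UNIV. line_integral (\<lambda>x. Im (coord q (e j * \<Psi> (point e x)))) \<gamma> j)"
proof -
  define \<kappa> where "\<kappa> j r = coord q (e j * I r)" for j r
  define A where "A r j = line_integral (\<lambda>x. Re (coord r (\<Psi> (point e x)))) \<gamma> j" for r j
  define B where "B r j = line_integral (\<lambda>x. Im (coord r (\<Psi> (point e x)))) \<gamma> j" for r j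
  have A: "has_stieltjes_integral (\<lambda>t. Re (coord r (\<Psi> (point e (\<gamma> t))))) (\<lambda>t. \<gamma> t $ j) (A r j)"
    and B: "has_stieltjes_integral (\<lambda>t. Im (coord r (\<Psi> (point e (\<gamma> t))))) (\<lambda>t. \<gamma> t $ j) (B r j)"
    if "r \<in> {1..n}" for r j
    unfolding A_def B_def
    using rect cont[OF that] by (auto intro!: has_stieltjes_integral_line_integral continuous_intros)
  have LI: "line_integral U \<gamma> j = J" if "has_stieltjes_integral (\<lambda>t. U (\<gamma> t)) (\<lambda>t. \<gamma> t $ j) J" for U j J
    unfolding line_integral_def using that has_stieltjes_integral_unique by (blast intro: the_equality)
  have Re: "line_integral (\<lambda>x. Re (coord q (e j * \<Psi> (point e x)))) \<gamma> j = (\<Sum>r = 1..n. Re (\<kappa> j r) * A r j + (- Im (\<kappa> j r)) * B r j)" for j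
  proof (rule LI)
    have "has_stieltjes_integral (\<lambda>t. \<Sum>r = 1..n. Re (\<kappa> j r) * Re (coord r (\<Psi> (point e (\<gamma> t)))) + (- Im (\<kappa> j r)) * Im (coord r (\<Psi> (point e (\<gamma> t)))))
       (\<lambda>t. \<gamma> t $ j) (\<Sum>r = 1..n. Re (\<kappa> j r) * A r j + (- Im (\<kappa> j r)) * B r j)"
      by (intro has_stieltjes_integral_sum has_stieltjes_integral_add has_stieltjes_integral_cmult A B) auto
    then show "has_stieltjes_integral (\<lambda>t. Re (coord q (e j * \<Psi> (point e (\<gamma> t))))) (\<lambda>t. \<gamma> t $ j) (\<Sum>r = 1..n. Re (\<kappa> j r) * A r j + (- Im (\<kappa> j r)) * B r j)"
      by (simp add: coord_mult_right[of q "e j" "\<Psi> _"] \<kappa>_def algebra_simps del: One_nat_def)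
  qed
  have Im: "line_integral (\<lambda>x. Im (coord q (e j * \<Psi> (point e x)))) \<gamma> j = (\<Sum>r = 1..n. Im (\<kappa> j r) * A r j + Re (\<kappa> j r) * B r j)" for j
  proof (rule LI)
    have "has_stieltjes_integral (\<lambda>t. \<Sum>r = 1..n. Im (\<kappa> j r) * Re (coord r (\<Psi> (point e (\<gamma> t)))) + Re (\<kappa> j r) * Im (coord r (\<Psi> (point e (\<gamma> t)))))
       (\<lambda>t. \<gamma> t $ j) (\<Sum>r = 1..n. Im (\<kappa> j r) * A r j + Re (\<kappa> j r) * B r j)"
      by (intro has_stieltjes_integral_sum has_stieltjes_integral_add has_stieltjes_integral_cmult A B) auto
    then show "has_stieltjes_integral (\<lambda>t. Im (coord q (e j * \<Psi> (point e (\<gamma> t))))) (\<lambda>t. \<gamma> t $ j) (\<Sum>r = 1..n. Im (\<kappa> j r) * A r j + Re (\<kappa> j r) * B r j)"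
      by (simp add: coord_mult_right[of q "e j" "\<Psi> _"] \<kappa>_def algebra_simps del: One_nat_def)
  qed
  have "coord q (e j * (\<Sum>r = 1..n. scale (complex_of_real (X r)) (I r))) = (\<Sum>r = 1..n. of_real (X r) * \<kappa> j r)" for X j
    by (simp add: sum_distrib_left scale_mult_right[symmetric] coord_sum coord_scale \<kappa>_def del: One_nat_def)
  then have "coord q (alg_integral e \<gamma> \<Psi>) = (\<Sum>j\<in>UNIV. \<Sum>r = 1..n. of_real (A r j) * \<kappa> j r) + \<i> * (\<Sum>j\<in>UNIV. \<Sum>r = 1..n. of_real (B r j) * \<kappa> j r)"
    unfolding alg_integral_def A_def[symmetric] B_def[symmetric] by (simp only: coord_add coord_scale coord_sum)
  also have "\<dots> = Complex (\<Sum>j\<in>UNIV. \<Sum>r = 1..n. Re (\<kappa> j r) * A r j + (- Im (\<kappa> j r)) * B r j) (\<Sum>j\<in>UNIV. \<Sum>r = 1..n. Im (\<kappa> j r) * A r j + Re (\<kappa> j r) * B r j)"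
    by (simp add: complex_eq_iff sum.distrib sum_negf sum_subtractf mult.commute del: One_nat_def)
  finally show ?thesis unfolding Re Im .
qed

text \<open>In the coordinate \<open>q\<close> the form \<open>\<Phi>(\<zeta>) d\<zeta>\<close> is \<open>\<Sum>j. coord q (e j * \<Phi>) dx\<^sub>j\<close>. On balls its real and imaginary
  parts are the differentials of those of \<open>coord q (V x)\<close>, where \<open>V\<close> is a primitive of \<open>\<Phi>\<close>.\<close>

theorem cauchy_monogenic:
  assumes dom: "is_domain e \<Omega>" and mono: "monogenic_on e \<Omega> \<Phi>"
    and \<gamma>: "closed_jordan_rectifiable \<gamma>" and img: "path_image \<gamma> \<subseteq> real_set e \<Omega>"
    and hom: "homotopic_to_point e \<Omega> \<gamma>"
  shows "alg_integral e \<gamma> \<Phi> = 0"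
proof -
  let ?G = "real_set e \<Omega>"
  define F where "F x = \<Phi> (point e x)" for x
  have rect: "rectifiable \<gamma>" using \<gamma> by (simp add: closed_jordan_rectifiable_def)
  have "open ?G" using dom by (simp add: is_domain_def)
  obtain a where hom: "homotopic_loops ?G \<gamma> (\<lambda>t. a)" using hom by (auto simp: homotopic_to_point_def)
  have mF: "monogenic_coords ?G F"
    unfolding F_def by (rule monogenic_on_imp_monogenic_coords[OF mono])
  have contF: "continuous_on ?G (\<lambda>x. coord q (F x))" if "q \<in> {1..n}" for q
    using mF that by (auto simp: monogenic_coords_def)
  have contP: "continuous_on ?G (\<lambda>x. coord q (e j * F x))" for q j
    by (subst coord_mult_right) (intro continuous_intros contF)
  have prim: "\<exists>V. \<forall>x\<in>ball p r. has_alg_derivative V (\<lambda>h. point e h * F x) x" if "ball p r \<subseteq> ?G" for p r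
  proof (rule monogenic_has_primitive[where s = 1])
    show "monogenic_coords (ball p r) F"
      using mF that unfolding monogenic_coords_def by (blast intro: continuous_on_subset)
  qed (auto simp: filtration_def)
  have coord_form: "coord q (point e h * F x) = (\<Sum>j\<in>UNIV. of_real (h $ j) * coord q (e j * F x))" for q h x
    by (simp add: point_def sum_distrib_right coord_sum scale_mult_left[symmetric] coord_scale)
  have zero: "(\<Sum>j\<in>UNIV. line_integral (\<lambda>x. \<rho> (coord q (e j * F x))) \<gamma> j) = 0"
    if "q \<in> {1..n}" and \<rho>: "bounded_linear \<rho>" for q and \<rho> :: "complex \<Rightarrow> real"
  proof (rule locally_exact_line_integral_eq_0[OF \<open>open ?G\<close> rect hom])
    interpret \<rho>: bounded_linear \<rho> by fact
    show "continuous_on ?G (\<lambda>x. \<rho> (coord q (e j * F x)))" for j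
      by (rule \<rho>.continuous_on[OF contP])
    fix p r assume "ball p r \<subseteq> ?G"
    from prim[OF this] obtain V where V: "\<And>x. x \<in> ball p r \<Longrightarrow> has_alg_derivative V (\<lambda>h. point e h * F x) x" by blast
    have "((\<lambda>x. \<rho> (coord q (V x))) has_derivative (\<lambda>h. \<Sum>j\<in>UNIV. \<rho> (coord q (e j * F x)) * h $ j)) (at x)" if "x \<in> ball p r" for x
    proof -
      have "((\<lambda>x. \<rho> (coord q (V x))) has_derivative (\<lambda>h. \<rho> (coord q (point e h * F x)))) (at x)"
        using V[OF that] \<open>q \<in> {1..n}\<close> unfolding has_alg_derivative_def by (intro \<rho>.has_derivative) blast
      moreover have "\<rho> (coord q (point e h * F x)) = (\<Sum>j\<in>UNIV. \<rho> (coord q (e j * F x)) * h $ j)" for h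
        unfolding coord_form \<rho>.sum scaleR_conv_of_real[symmetric] \<rho>.scaleR by (simp add: mult.commute)
      ultimately show ?thesis by simp
    qed
    then show "\<exists>V. \<forall>x\<in>ball p r. (V has_derivative (\<lambda>h. \<Sum>j\<in>UNIV. \<rho> (coord q (e j * F x)) * h $ j)) (at x)" by blast
  qed
  show ?thesis
  proof (rule coord_eqI)
    fix q assume q: "q \<in> {1..n}"
    have "coord q (alg_integral e \<gamma> \<Phi>) = Complex 0 0"
      using zero[OF q bounded_linear_Re] zero[OF q bounded_linear_Im]
      by (subst coord_alg_integral[OF rect]) (auto simp: F_def intro: continuous_on_subset[OF contF[unfolded F_def] img])
    then show "coord q (alg_integral e \<gamma> \<Phi>) = coord q 0" by (simp add: complex_eq_iff)
  qed
qed

end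

theorem theorem2:
  fixes scale :: "complex \<Rightarrow> 'a::comm_ring_1 \<Rightarrow> 'a"
    and n m :: nat
    and I :: "nat \<Rightarrow> 'a"
    and \<Upsilon> :: "nat \<Rightarrow> nat \<Rightarrow> nat \<Rightarrow> complex"
    and e :: "'k::finite \<Rightarrow> 'a"
    and j1 :: 'k
    and \<Omega> :: "'a set"
    and \<Phi> :: "'a \<Rightarrow> 'a"
    and \<gamma> :: "real \<Rightarrow> real ^ 'k"
  assumes "cartan_subspace scale n m I \<Upsilon> e j1"
    and "cartan_algebra.is_domain scale e \<Omega>"
    and "cartan_algebra.monogenic_on scale n I e \<Omega> \<Phi>"
    and "closed_jordan_rectifiable \<gamma>"
    and "path_image \<gamma> \<subseteq> cartan_algebra.real_set scale e \<Omega>"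
    and "cartan_algebra.homotopic_to_point scale e \<Omega> \<gamma>"
  shows "cartan_algebra.alg_integral scale n I e \<gamma> \<Phi> = 0"
  by (rule cartan_subspace.cauchy_monogenic[OF assms])

end
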